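(* Let $A$ be a scalar type spectral operator in a complex Banach space $(X,\|\cdot\|)$ and let $1\le\beta<\infty$. Then the following statements are equivalent. (i) Every weak solution of the evolution equation $y'(t)=Ay(t)$, $t\ge 0$, belongs to the $\beta$th-order Gevrey class $\mathscr{E}^{(\beta)}([0,\infty),X)$ of Beurling type. (ii) Every weak solution of the evolution equation $y'(t)=Ay(t)$, $t\ge 0$, belongs to the $\beta$th-order Gevrey class $\mathscr{E}^{\{\beta\}}([0,\infty),X)$ of Roumieu type. (iii) There is a $b_+>0$ such that the set $\sigma(A)\setminus\mathscr{P}^{\beta}_{b_+}$ is bounded, where $$\mathscr{P}^{\beta}_{b_+}:=\left\{\lambda\in\mathbb{C}\,\middle|\,\operatorname{Re}\lambda\ge b_+|\operatorname{Im}\lambda|^{1/\beta}\right\}$$ and $\sigma(A)$ is the spectrum of $A$.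
   Context: **Scalar type spectral operator (in the sense of Dunford).** A closed densely defined linear operator $A$ (possibly unbounded) in a complex Banach space $X$ for which there is a strongly $\sigma$-additive spectral measure $E_A(\cdot)$ (resolution of the identity) assigning to each Borel set $\delta\subseteq\mathbb{C}$ a bounded projection operator $E_A(\delta)$ on $X$, with $E_A(\emptyset)=0$, $E_A(\mathbb{C})=I$, $E_A(\delta)E_A(\sigma)=E_A(\delta\cap\sigma)$, having the spectrum $\sigma(A)$ as its support, and such that $A=\int_{\sigma(A)}\lambda\,dE_A(\lambda)$, i.e., $Af=\lim_{n\to\infty}\int_{\{\lambda\in\sigma(A):|\lambda|\le n\}}\lambda\,dE_A(\lambda)f$ with $D(A)$ being the set of all $f\in X$ for which this limit exists. $A$ is not assumed to generate a $C_0$-semigroup. **Weak solution.** A strongly continuous function $y:[0,\infty)\to X$ is a weak solution of $y'(t)=Ay(t)$, $t\ge0$, if for every $g^*\in D(A^* )$, $$\frac{d}{dt}\langle y(t),g^*\rangle=\langle y(t),A^*g^*\rangle,\quad t\ge 0,$$ where $A^*$ is the adjoint of $A$ and $\langle\cdot,\cdot\rangle$ is the pairing between $X$ and its dual $X^*$. Equivalently, for all $t\ge0$, $\int_0^t y(s)\,ds\in D(A)$ and $y(t)=y(0)+A\int_0^t y(s)\,ds$. **Gevrey classes of functions.** For an interval $I\subseteq(-\infty,\infty)$ let $C^\infty(I,X)$ be the space of all $X$-valued functions strongly infinitely differentiable on $I$ (one-sided derivatives at endpoints belonging to $I$). For $0\le\beta<\infty$, with $\mathbb{Z}_+=\{0,1,2,\dots\}$: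 $\mathscr{E}^{\{\beta\}}(I,X)$ (Roumieu type) is the set of $g\in C^\infty(I,X)$ such that for every $[a,b]\subseteq I$ there exist $\alpha>0$ and $c>0$ with $\max_{a\le t\le b}\|g^{(n)}(t)\|\le c\,\alpha^n[n!]^\beta$ for all $n\in\mathbb{Z}_+$; $\mathscr{E}^{(\beta)}(I,X)$ (Beurling type) is the set of $g\in C^\infty(I,X)$ such that for every $[a,b]\subseteq I$ and every $\alpha>0$ there exists $c>0$ with $\max_{a\le t\le b}\|g^{(n)}(t)\|\le c\,\alpha^n[n!]^\beta$ for all $n\in\mathbb{Z}_+$. *)

theory Defs
  imports "HOL-Analysis.Analysis"
begin

section \<open>Complex Banach spaces\<close>

class complex_banach = banach +
  fixes scaleC :: "complex \<Rightarrow> 'a \<Rightarrow> 'a" (infixr \<open>*\<^sub>C\<close> 75)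
  assumes scaleC_add_right: "c *\<^sub>C (x + y) = c *\<^sub>C x + c *\<^sub>C y"
    and scaleC_add_left: "(c + d) *\<^sub>C x = c *\<^sub>C x + d *\<^sub>C x"
    and scaleC_scaleC: "c *\<^sub>C d *\<^sub>C x = (c * d) *\<^sub>C x"
    and scaleC_of_real: "complex_of_real r *\<^sub>C x = r *\<^sub>R x"
    and norm_scaleC: "norm (c *\<^sub>C x) = cmod c * norm x"

instantiation complex :: complex_banach
begin

definition scaleC_complex :: "complex \<Rightarrow> complex \<Rightarrow> complex"
  where "scaleC_complex c z = c * z"

instance
  by standard (auto simp: scaleC_complex_def algebra_simps norm_mult scaleR_conv_of_real)

end

definition bounded_clinear :: "('a::complex_banach \<Rightarrow> 'b::complex_banach) \<Rightarrow> bool"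
  where "bounded_clinear T \<longleftrightarrow> bounded_linear T \<and> (\<forall>c x. T (c *\<^sub>C x) = c *\<^sub>C T x)"


section \<open>Unbounded operators\<close>

text \<open>
  An operator is given by its domain \<open>D\<close> and a function \<open>A\<close>; the values of \<open>A\<close> outside
  \<open>D\<close> never matter.
\<close>

definition closed_densely_defined :: "'a::complex_banach set \<Rightarrow> ('a \<Rightarrow> 'a) \<Rightarrow> bool"
  where "closed_densely_defined D A \<longleftrightarrow>
    0 \<in> D \<and>
    (\<forall>x\<in>D. \<forall>y\<in>D. x + y \<in> D \<and> A (x + y) = A x + A y) \<and>
    (\<forall>c. \<forall>x\<in>D. c *\<^sub>C x \<in> D \<and> A (c *\<^sub>C x) = c *\<^sub>C A x) \<and>
    closed ((\<lambda>x. (x, A x)) ` D) \<and>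
    closure D = UNIV"

definition resolvent_set :: "'a::complex_banach set \<Rightarrow> ('a \<Rightarrow> 'a) \<Rightarrow> complex set"
  where "resolvent_set D A = {z. \<exists>R. bounded_clinear R \<and>
    (\<forall>x. R x \<in> D \<and> A (R x) - z *\<^sub>C R x = x) \<and>
    (\<forall>x\<in>D. R (A x - z *\<^sub>C x) = x)}"

definition spectrum :: "'a::complex_banach set \<Rightarrow> ('a \<Rightarrow> 'a) \<Rightarrow> complex set"
  where "spectrum D A = - resolvent_set D A"

definition adjoint_domain :: "'a::complex_banach set \<Rightarrow> ('a \<Rightarrow> 'a) \<Rightarrow> ('a \<Rightarrow> complex) set"
  where "adjoint_domain D A =
    {g. bounded_clinear g \<and> (\<exists>h. bounded_clinear h \<and> (\<forall>x\<in>D. g (A x) = h x))}"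

text \<open>For densely defined operators, the functional below is unique.\<close>

definition adjoint_op ::
    "'a::complex_banach set \<Rightarrow> ('a \<Rightarrow> 'a) \<Rightarrow> ('a \<Rightarrow> complex) \<Rightarrow> 'a \<Rightarrow> complex"
  where "adjoint_op D A g = (THE h. bounded_clinear h \<and> (\<forall>x\<in>D. g (A x) = h x))"


section \<open>Scalar type spectral operators\<close>

text \<open>
  Only the values of \<open>E\<close> on Borel sets matter. That each \<open>E \<delta>\<close> is a projection is the
  case \<open>\<delta> = \<sigma>\<close> of multiplicativity.
\<close>

definition spectral_measure :: "(complex set \<Rightarrow> 'a::complex_banach \<Rightarrow> 'a) \<Rightarrow> bool"
  where "spectral_measure E \<longleftrightarrow>
    (\<forall>\<delta>\<in>sets borel. bounded_clinear (E \<delta>)) \<and>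
    (\<forall>x. E {} x = 0) \<and>
    (\<forall>x. E UNIV x = x) \<and>
    (\<forall>\<delta>\<in>sets borel. \<forall>\<sigma>\<in>sets borel. \<forall>x. E \<delta> (E \<sigma> x) = E (\<delta> \<inter> \<sigma>) x) \<and>
    (\<forall>\<delta> :: nat \<Rightarrow> complex set. range \<delta> \<subseteq> sets borel \<longrightarrow> disjoint_family \<delta> \<longrightarrow>
      (\<forall>x. (\<lambda>n. E (\<delta> n) x) sums E (\<Union>n. \<delta> n) x))"

definition spectral_support :: "(complex set \<Rightarrow> 'a::complex_banach \<Rightarrow> 'a) \<Rightarrow> complex set"
  where "spectral_support E = - \<Union>{U. open U \<and> (\<forall>x. E U x = 0)}"

text \<open>
  The vector \<open>\<integral>\<^sub>\<delta> f dE x\<close>, for a Borel set \<open>\<delta>\<close> and a function \<open>f\<close> that is bounded and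
  Borel measurable on \<open>\<delta>\<close>: the limit of the integrals of any Borel simple functions
  converging to \<open>f\<close> uniformly on \<open>\<delta>\<close>. It does not depend on their choice because
  a strongly \<open>\<sigma>\<close>-additive \<open>E\<close> is uniformly bounded.
\<close>

definition spectral_integral ::
    "(complex set \<Rightarrow> 'a::complex_banach \<Rightarrow> 'a) \<Rightarrow> complex set \<Rightarrow> (complex \<Rightarrow> complex) \<Rightarrow> 'a \<Rightarrow> 'a"
  where "spectral_integral E \<delta> f x =
    (THE y. \<exists>s :: nat \<Rightarrow> complex \<Rightarrow> complex.
      (\<forall>n. simple_function borel (s n)) \<and>
      uniform_limit \<delta> s f sequentially \<and>
      (\<lambda>n. \<Sum>c\<in>range (s n). c *\<^sub>C E (s n -` {c} \<inter> \<delta>) x) \<longlonglongrightarrow> y)"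

definition scalar_type_spectral :: "'a::complex_banach set \<Rightarrow> ('a \<Rightarrow> 'a) \<Rightarrow> bool"
  where "scalar_type_spectral D A \<longleftrightarrow>
    closed_densely_defined D A \<and>
    (\<exists>E. spectral_measure E \<and>
      spectral_support E = spectrum D A \<and>
      D = {x. convergent
            (\<lambda>n. spectral_integral E {z \<in> spectrum D A. cmod z \<le> real n} (\<lambda>z. z) x)} \<and>
      (\<forall>x\<in>D. (\<lambda>n. spectral_integral E {z \<in> spectrum D A. cmod z \<le> real n} (\<lambda>z. z) x)
            \<longlonglongrightarrow> A x))"


section \<open>Weak solutions\<close>

definition weak_solution ::
    "'a::complex_banach set \<Rightarrow> ('a \<Rightarrow> 'a) \<Rightarrow> (real \<Rightarrow> 'a) \<Rightarrow> bool"
  where "weak_solution D A y \<longleftrightarrow>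
    continuous_on {0..} y \<and>
    (\<forall>g\<in>adjoint_domain D A. \<forall>t\<ge>0.
      ((\<lambda>s. g (y s)) has_vector_derivative adjoint_op D A g (y t)) (at t within {0..}))"


section \<open>Gevrey classes\<close>

text \<open>
  In the following, \<open>I\<close> is a nondegenerate interval, so that derivatives within \<open>I\<close> are
  unique, and one-sided at the endpoints belonging to \<open>I\<close>.
\<close>

primrec nth_deriv :: "real set \<Rightarrow> nat \<Rightarrow> (real \<Rightarrow> 'a::real_normed_vector) \<Rightarrow> real \<Rightarrow> 'a"
  where
    "nth_deriv I 0 g = g"
  | "nth_deriv I (Suc n) g = (\<lambda>t. vector_derivative (nth_deriv I n g) (at t within I))"

definition C_infinity :: "real set \<Rightarrow> (real \<Rightarrow> 'a::real_normed_vector) set"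
  where "C_infinity I = {g. \<forall>n. nth_deriv I n g differentiable_on I}"

definition gevrey_roumieu :: "real \<Rightarrow> real set \<Rightarrow> (real \<Rightarrow> 'a::real_normed_vector) set"
  where "gevrey_roumieu \<beta> I = {g \<in> C_infinity I.
    \<forall>a b. {a..b} \<subseteq> I \<longrightarrow> (\<exists>\<alpha>>0. \<exists>c>0. \<forall>n. \<forall>t\<in>{a..b}.
      norm (nth_deriv I n g t) \<le> c * \<alpha> ^ n * fact n powr \<beta>)}"

definition gevrey_beurling :: "real \<Rightarrow> real set \<Rightarrow> (real \<Rightarrow> 'a::real_normed_vector) set"
  where "gevrey_beurling \<beta> I = {g \<in> C_infinity I.
    \<forall>a b. {a..b} \<subseteq> I \<longrightarrow> (\<forall>\<alpha>>0. \<exists>c>0. \<forall>n. \<forall>t\<in>{a..b}.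
      norm (nth_deriv I n g t) \<le> c * \<alpha> ^ n * fact n powr \<beta>)}"


section \<open>The regions in the complex plane\<close>

definition P_region :: "real \<Rightarrow> real \<Rightarrow> complex set"
  where "P_region \<beta> b = {z. Re z \<ge> b * \<bar>Im z\<bar> powr (1 / \<beta>)}"

end

theory Submission
  imports Defs
begin

text \<open>
  Every weak solution behaves like \<open>y t = exp (t A) f\<close>, and the \<open>n\<close>-th derivative of the right-hand
  side has the symbol \<open>z ^ n * exp (t z)\<close> on the spectrum. The theorem compares the growth of this
  symbol in \<open>n\<close> with the geometry of the spectrum.

  The exponentials of the unbounded operator are reached through bounded functions only. The
  spectral measure is uniformly bounded (\<open>uniformly_bounded\<close>), so bounded Borel functions have integrals \<open>Phi f\<close>, and \<open>Phi\<close> is linear,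
  multiplicative and continuous from the supremum norm to the operator norm. On the range of \<open>E \<delta>\<close>
  for bounded \<open>\<delta>\<close> the operator \<open>A\<close> is bounded, and a weak solution is shown to solve a linear
  equation with bounded coefficients there (\<open>weak_solution_strong_deriv\<close>); since weak solutions are
  tested by functionals only, this rests on the Hahn--Banach theorem. Consequently a solution can be
  traced backwards, \<open>y t = exp ((t - T) A) y T\<close> for \<open>t < T\<close>, whenever \<open>exp ((t - T) z)\<close> is bounded on
  the spectrum (\<open>weak_solution_backward\<close>).

  If the spectrum lies in \<open>P_region \<beta> b\<close> up to a bounded set, then \<open>cmod z\<close> is at most a multiple of
  \<open>Re z powr \<beta>\<close> on its unbounded part, and \<open>cmod z ^ n * exp (- s * Re z)\<close> is at most
  \<open>\<alpha> ^ n * fact n powr \<beta>\<close>, where \<open>\<alpha>\<close> tends to \<open>0\<close> as \<open>s = T - t\<close> grows. Solutions exist for all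
  times, so \<open>T\<close> may be taken as large as desired: the estimates are automatically of Beurling type
  (\<open>sector_imp_beurling\<close>).

  Conversely, if no such region captures the spectrum up to a bounded set, there are spectral points
  \<open>L n\<close> tending to infinity with \<open>n * max (Re (L n)) 0\<close> of smaller order than \<open>cmod (L n) powr (1 / \<beta>)\<close>.
  Superposing normalized vectors from spectral subspaces near these points, with weights that barely
  compensate \<open>exp (t * Re (L n))\<close> for every \<open>t\<close>, gives a weak solution whose derivatives at \<open>0\<close> violate
  every Roumieu bound (\<open>roumieu_imp_sector\<close>). As Beurling classes are contained in Roumieu classes,
  this closes the circle.
\<close>


section \<open>Complex scalar multiplication\<close>

lemma scaleC_zero_left [simp]: "0 *\<^sub>C x = (0::'a::complex_banach)"
  using scaleC_of_real[of 0 x] by simp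

lemma scaleC_zero_right [simp]: "c *\<^sub>C (0::'a::complex_banach) = 0"
  using norm_scaleC[of c "0::'a"] by simp

lemma scaleC_one [simp]: "1 *\<^sub>C x = (x::'a::complex_banach)"
  using scaleC_of_real[of 1 x] by simp

lemma bounded_bilinear_scaleC:
  "bounded_bilinear (scaleC :: complex \<Rightarrow> 'a::complex_banach \<Rightarrow> 'a)"
proof
  fix a a' :: complex and b b' :: 'a and r :: real
  show "(a + a') *\<^sub>C b = a *\<^sub>C b + a' *\<^sub>C b" by (rule scaleC_add_left)
  show "a *\<^sub>C (b + b') = a *\<^sub>C b + a *\<^sub>C b'" by (rule scaleC_add_right)
  show "(r *\<^sub>R a) *\<^sub>C b = r *\<^sub>R a *\<^sub>C b"
    by (simp add: scaleC_scaleC scaleR_conv_of_real flip: scaleC_of_real)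
  show "a *\<^sub>C r *\<^sub>R b = r *\<^sub>R a *\<^sub>C b"
    by (simp add: scaleC_scaleC mult.commute flip: scaleC_of_real)
  show "\<exists>K. \<forall>a b. norm (a *\<^sub>C (b::'a)) \<le> norm a * norm b * K"
    by (rule exI[of _ 1]) (simp add: norm_scaleC)
qed

interpretation scaleC: bounded_bilinear
  "scaleC :: complex \<Rightarrow> 'a::complex_banach \<Rightarrow> 'a"
  by (rule bounded_bilinear_scaleC)

lemma bounded_clinear_scaleC: "bounded_clinear T \<Longrightarrow> T (c *\<^sub>C x) = c *\<^sub>C T x"
  by (simp add: bounded_clinear_def)

lemma bounded_clinear_imp_linear: "bounded_clinear T \<Longrightarrow> bounded_linear T"
  by (simp add: bounded_clinear_def)

lemma bounded_clinear_compose: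
  "bounded_clinear S \<Longrightarrow> bounded_clinear T \<Longrightarrow> bounded_clinear (\<lambda>x. S (T x))"
  by (simp add: bounded_clinear_def bounded_linear_compose)


section \<open>Continuous functionals separate points\<close>

text \<open>
  The Hahn--Banach argument works with sublinear minorants of the norm. Such a minorant that is
  minimal is automatically linear, so Zorn's lemma replaces the usual extension of functionals
  from subspaces.
\<close>

definition sublinear :: "('a::real_normed_vector \<Rightarrow> real) \<Rightarrow> bool"
  where "sublinear p \<longleftrightarrow> (\<forall>x y. p (x + y) \<le> p x + p y) \<and>
    (\<forall>r\<ge>0. \<forall>x. p (r *\<^sub>R x) = r * p x) \<and> (\<forall>x. p x \<le> norm x)"

lemma sublinear_zero: "sublinear p \<Longrightarrow> p 0 = 0"
  unfolding sublinear_def by (metis mult_zero_left order_refl scaleR_zero_left)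

lemma sublinear_lower: "sublinear p \<Longrightarrow> - norm x \<le> p x"
proof -
  assume p: "sublinear p"
  have "p (x + - x) \<le> p x + p (- x)" "p (- x) \<le> norm (- x)"
    using p unfolding sublinear_def by blast+
  then show ?thesis using sublinear_zero[OF p] by simp
qed

text \<open>
  Lowering a sublinear functional along one direction \<open>y\<close>: the result is the largest sublinear
  minorant \<open>q\<close> of \<open>p\<close> with \<open>q (- y) \<le> - p y\<close>.
\<close>

lemma sublinear_lower_along:
  assumes p: "sublinear p"
  obtains q where "sublinear q" "\<And>x. q x \<le> p x"
    "\<And>x. q x \<le> p (x + y) - p y"
proof -
  define F where "F x t = p (x + t *\<^sub>R y) - t * p y" for x and t :: real
  define q where "q x = (INF t\<in>{0..}. F x t)" for x
  have add: "\<And>x z. p (x + z) \<le> p x + p z" and hom: "\<And>r x. r \<ge> 0 \<Longrightarrow> p (r *\<^sub>R x) = r * p x"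
    and nrm: "\<And>x. p x \<le> norm x"
    using p unfolding sublinear_def by blast+
  have low: "- norm x \<le> F x t" if "t \<ge> 0" for x t
  proof -
    have "t * p y = p (t *\<^sub>R y)" using hom that by simp
    also have "\<dots> \<le> p (x + t *\<^sub>R y) + p (- x)" using add[of "x + t *\<^sub>R y" "- x"] by simp
    also have "\<dots> \<le> p (x + t *\<^sub>R y) + norm x" using nrm[of "- x"] by simp
    finally show ?thesis by (simp add: F_def)
  qed
  have bdd: "bdd_below (F x ` {0..})" for x
    by (rule bdd_belowI[of _ "- norm x"]) (use low in auto)
  have q_le: "q x \<le> F x t" if "t \<ge> 0" for x t
    unfolding q_def by (rule cINF_lower[OF bdd]) (use that in auto)
  have q_ge: "c \<le> q x" if "\<And>t. t \<ge> 0 \<Longrightarrow> c \<le> F x t" for x c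
    unfolding q_def by (rule cINF_greatest) (use that in auto)
  have qp: "q x \<le> p x" for x using q_le[of 0 x] by (simp add: F_def)
  have q_add: "q (x + z) \<le> q x + q z" for x z
  proof -
    have "q (x + z) \<le> F x t + F z s" if "t \<ge> 0" "s \<ge> 0" for t s
    proof -
      have "q (x + z) \<le> F (x + z) (t + s)" using q_le that by simp
      also have "\<dots> \<le> F x t + F z s"
        using add[of "x + t *\<^sub>R y" "z + s *\<^sub>R y"] by (simp add: F_def algebra_simps)
      finally show ?thesis .
    qed
    then have "q (x + z) - F z s \<le> q x" if "s \<ge> 0" for s
      using that by (intro q_ge) (simp add: algebra_simps)
    then have "q (x + z) - q x \<le> q z"
      by (intro q_ge) (simp add: algebra_simps)
    then show ?thesis by simp
  qed
  have q_hom_le: "r * q x \<le> q (r *\<^sub>R x)" if r: "r > 0" for r x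
  proof (rule q_ge)
    fix t :: real assume t: "t \<ge> 0"
    have "r * q x \<le> r * F x (t / r)"
      using q_le[of "t / r" x] r t by (intro mult_left_mono) auto
    also have "\<dots> = p (r *\<^sub>R (x + (t / r) *\<^sub>R y)) - t * p y"
      using r hom[of r "x + (t / r) *\<^sub>R y"] by (simp add: F_def algebra_simps)
    also have "\<dots> = F (r *\<^sub>R x) t" using r by (simp add: F_def scaleR_add_right)
    finally show "r * q x \<le> F (r *\<^sub>R x) t" .
  qed
  have q_hom: "q (r *\<^sub>R x) = r * q x" if "r \<ge> 0" for r x
  proof (cases "r = 0")
    case True
    have "q 0 \<le> 0" using qp[of 0] sublinear_zero[OF p] by simp
    moreover have "0 \<le> q 0" using low[of _ 0] by (intro q_ge) simp
    ultimately show ?thesis using True by simp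
  next
    case False
    then have r: "r > 0" using that by simp
    have "inverse r * q (r *\<^sub>R x) \<le> q (inverse r *\<^sub>R (r *\<^sub>R x))"
      using q_hom_le[of "inverse r"] r by (simp del: scaleR_scaleR)
    then have "q (r *\<^sub>R x) \<le> r * q x" using r by (simp add: field_simps)
    then show ?thesis using q_hom_le[OF r, of x] by simp
  qed
  have "sublinear q"
    unfolding sublinear_def using q_add q_hom qp nrm by (blast intro: order_trans)
  moreover have "q x \<le> p (x + y) - p y" for x using q_le[of 1 x] by (simp add: F_def)
  ultimately show ?thesis using that qp by blast
qed

lemma minimal_sublinear_linear:
  assumes p: "sublinear p" and min: "\<And>q. sublinear q \<Longrightarrow> (\<And>x. q x \<le> p x) \<Longrightarrow> q = p"
  shows "bounded_linear p"
proof -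
  have sub: "\<And>x z. p (x + z) \<le> p x + p z" and hom: "\<And>r x. r \<ge> 0 \<Longrightarrow> p (r *\<^sub>R x) = r * p x"
    and nrm: "\<And>x. p x \<le> norm x"
    using p unfolding sublinear_def by blast+
  have add: "p (x + y) = p x + p y" for x y
  proof -
    obtain q where "sublinear q" "\<And>x. q x \<le> p x" "\<And>x. q x \<le> p (x + y) - p y"
      using sublinear_lower_along[OF p] by metis
    then have "p x \<le> p (x + y) - p y" using min[of q] by metis
    then show ?thesis using sub[of x y] by simp
  qed
  have neg: "p (- x) = - p x" for x
    using add[of x "- x"] sublinear_zero[OF p] by simp
  have scale: "p (r *\<^sub>R x) = r * p x" for r x
  proof (cases "r \<ge> 0")
    case False
    then have "p ((- r) *\<^sub>R x) = (- r) * p x" using hom[of "- r"] by (simp del: scaleR_minus_left)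
    then show ?thesis using neg[of "r *\<^sub>R x"] by simp
  qed (use hom in simp)
  show ?thesis
  proof (rule bounded_linear_intro[of _ 1])
    fix x show "norm (p x) \<le> norm x * 1"
      using nrm[of x] sublinear_lower[OF p, of x] by (simp add: abs_le_iff)
  qed (use add scale in simp_all)
qed

lemma ex_minimal_sublinear:
  assumes p: "sublinear p"
  obtains m where "sublinear m" "\<And>x. m x \<le> p x"
    "\<And>q. sublinear q \<Longrightarrow> (\<And>x. q x \<le> m x) \<Longrightarrow> q = m"
proof -
  define S where "S = {q. sublinear q \<and> q \<le> p}"
  let ?R = "relation_of (\<lambda>a b. b \<le> a) S"
  have "\<exists>m\<in>S. \<forall>a\<in>S. a \<le> m \<longrightarrow> a = m"
  proof (rule predicate_Zorn)
    show "partial_order_on S ?R"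
      by (auto simp: partial_order_on_def preorder_on_def refl_on_def trans_def antisym_def
          relation_of_def)
  next
    fix C assume "C \<in> Chains ?R"
    then have CS: "C \<subseteq> S" and lin: "\<And>a b. a \<in> C \<Longrightarrow> b \<in> C \<Longrightarrow> a \<le> b \<or> b \<le> a"
      by (auto simp: Chains_def relation_of_def)
    show "\<exists>u\<in>S. \<forall>a\<in>C. u \<le> a"
    proof (cases "C = {}")
      case True
      then show ?thesis using p by (auto simp: S_def)
    next
      case False
      define u where "u x = (INF c\<in>C. c x)" for x
      have subC: "sublinear c" if "c \<in> C" for c using CS that by (auto simp: S_def)
      have bdd: "bdd_below ((\<lambda>c. c x) ` C)" for x
        by (rule bdd_belowI[of _ "- norm x"]) (use sublinear_lower subC in auto)
      have u_le: "u x \<le> c x" if "c \<in> C" for c x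
        unfolding u_def by (rule cINF_lower[OF bdd that])
      have u_ge: "d \<le> u x" if "\<And>c. c \<in> C \<Longrightarrow> d \<le> c x" for d x
        unfolding u_def by (rule cINF_greatest[OF False that])
      have add: "u (x + y) \<le> u x + u y" for x y
      proof -
        have "u (x + y) \<le> c x + d y" if cd: "c \<in> C" "d \<in> C" for c d
        proof -
          obtain e where e: "e \<in> C" "e \<le> c" "e \<le> d" using lin[OF cd] cd by blast
          have "u (x + y) \<le> e (x + y)" using u_le e by blast
          also have "\<dots> \<le> e x + e y" using subC[OF e(1)] by (simp add: sublinear_def)
          also have "\<dots> \<le> c x + d y" using e by (simp add: le_fun_def add_mono)
          finally show ?thesis .
        qed
        then have "u (x + y) - d y \<le> u x" if "d \<in> C" for d
          using that by (intro u_ge) (simp add: algebra_simps)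
        then have "u (x + y) - u x \<le> u y" by (intro u_ge) (simp add: algebra_simps)
        then show ?thesis by simp
      qed
      have le: "r * u x \<le> u (r *\<^sub>R x)" if "r \<ge> 0" for r x
      proof (rule u_ge)
        fix c assume c: "c \<in> C"
        have "r * u x \<le> r * c x" using u_le[OF c] that by (rule mult_left_mono)
        also have "\<dots> = c (r *\<^sub>R x)" using subC[OF c] that by (simp add: sublinear_def)
        finally show "r * u x \<le> c (r *\<^sub>R x)" .
      qed
      have hom: "u (r *\<^sub>R x) = r * u x" if r: "r \<ge> 0" for r x
      proof (cases "r = 0")
        case True
        obtain c where "c \<in> C" using False by blast
        then have "u 0 \<le> 0" using u_le[of c 0] sublinear_zero[OF subC[of c]] by simp
        moreover have "0 \<le> u 0" using sublinear_zero[OF subC] by (intro u_ge) (metis order_refl)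
        ultimately show ?thesis using True by simp
      next
        case False
        then have "inverse r * u (r *\<^sub>R x) \<le> u x" using le[of "inverse r" "r *\<^sub>R x"] r by simp
        then have "u (r *\<^sub>R x) \<le> r * u x" using False r by (simp add: field_simps)
        then show ?thesis using le[OF r, of x] by simp
      qed
      obtain c where c: "c \<in> C" using False by blast
      have "u x \<le> norm x" for x
        using u_le[OF c, of x] subC[OF c] by (auto simp: sublinear_def intro: order_trans)
      then have "sublinear u" using add hom by (simp add: sublinear_def)
      moreover have "u \<le> p"
        using u_le[OF c] CS c by (force simp: S_def le_fun_def intro: order_trans)
      ultimately show ?thesis using u_le by (auto simp: S_def le_fun_def)
    qed
  qed
  then obtain m where m: "m \<in> S" "\<forall>a\<in>S. a \<le> m \<longrightarrow> a = m" by blast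
  show ?thesis
  proof
    show "sublinear m" "\<And>x. m x \<le> p x" using m(1) by (auto simp: S_def le_fun_def)
    fix q assume "sublinear q" "\<And>x. q x \<le> m x"
    then have "q \<in> S" "q \<le> m" using m(1) by (auto simp: S_def le_fun_def intro: order_trans)
    then show "q = m" using m(2) by blast
  qed
qed

lemma ex_functional_nonzero_real:
  fixes x :: "'a::real_normed_vector"
  assumes "x \<noteq> 0"
  obtains g :: "'a \<Rightarrow> real" where "bounded_linear g" "g x \<noteq> 0"
proof -
  have "sublinear (norm :: 'a \<Rightarrow> real)"
    by (simp add: sublinear_def norm_triangle_ineq)
  then obtain q where q: "sublinear q" "\<And>z. q z \<le> norm (z + x) - norm x"
    using sublinear_lower_along by metis
  obtain m where m: "sublinear m" "\<And>z. m z \<le> q z"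
    "\<And>q. sublinear q \<Longrightarrow> (\<And>x. q x \<le> m x) \<Longrightarrow> q = m"
    using ex_minimal_sublinear[OF q(1)] by metis
  have lin: "bounded_linear m" using minimal_sublinear_linear m by blast
  have "m (- x) \<le> - norm x" using m(2)[of "- x"] q(2)[of "- x"] by simp
  then have "m x \<noteq> 0"
    using assms linear_neg[OF bounded_linear.linear[OF lin], of x] by auto
  then show ?thesis using lin that by blast
qed

text \<open>
  The complex functional with real part \<open>g\<close> is \<open>x \<mapsto> g x - \<i> g (\<i> x)\<close>.
\<close>

lemma ex_functional_nonzero:
  fixes x :: "'a::complex_banach"
  assumes "x \<noteq> 0"
  obtains G :: "'a \<Rightarrow> complex" where "bounded_clinear G" "G x \<noteq> 0"
proof -
  obtain g :: "'a \<Rightarrow> real" where g: "bounded_linear g" "g x \<noteq> 0"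
    using ex_functional_nonzero_real[OF assms] by blast
  interpret g: bounded_linear g by fact
  define G where "G z = Complex (g z) (- g (\<i> *\<^sub>C z))" for z
  have bl: "bounded_linear (\<lambda>z. \<i> *\<^sub>C z :: 'a)" by (rule scaleC.bounded_linear_right)
  have "bounded_linear (\<lambda>z. complex_of_real (g z) - \<i> * complex_of_real (g (\<i> *\<^sub>C z)))"
    by (intro bounded_linear_sub bounded_linear_const_mult bounded_linear_of_real
        bounded_linear_compose[OF bounded_linear_of_real] bounded_linear_compose[OF g(1)] bl g)
  moreover have "G = (\<lambda>z. complex_of_real (g z) - \<i> * complex_of_real (g (\<i> *\<^sub>C z)))"
    by (auto simp: G_def complex_eq_iff)
  ultimately have Gb: "bounded_linear G" by simp
  have "G (c *\<^sub>C z) = c *\<^sub>C G z" for c z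
  proof -
    have gc: "g (c *\<^sub>C w) = Re c * g w + Im c * g (\<i> *\<^sub>C w)" for w
    proof -
      have "c *\<^sub>C w = (complex_of_real (Re c) + complex_of_real (Im c) * \<i>) *\<^sub>C w"
        by (subst complex_eq[of c]) (simp add: mult.commute)
      also have "\<dots> = Re c *\<^sub>R w + Im c *\<^sub>R (\<i> *\<^sub>C w)"
        by (simp add: scaleC_add_left flip: scaleC_scaleC scaleC_of_real)
      finally show ?thesis by (simp add: g.add g.scaleR)
    qed
    have "\<i> *\<^sub>C c *\<^sub>C z = c *\<^sub>C \<i> *\<^sub>C z" by (simp add: scaleC_scaleC mult.commute)
    moreover have "\<i> *\<^sub>C \<i> *\<^sub>C z = - z"
      using scaleC_of_real[of "-1" z] by (simp add: scaleC_scaleC)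
    ultimately show ?thesis
      using gc[of z] gc[of "\<i> *\<^sub>C z"] by (simp add: G_def scaleC_complex_def complex_eq_iff g.neg)
  qed
  then have "bounded_clinear G" using Gb by (simp add: bounded_clinear_def)
  moreover have "G x \<noteq> 0" using g(2) by (simp add: G_def complex_eq_iff)
  ultimately show ?thesis using that by blast
qed

section \<open>Uniform boundedness\<close>

text \<open>
  The open sets \<open>{x. \<exists>i\<in>I. norm (T i x) > n}\<close> have empty intersection, so by Baire's theorem one of
  them misses a ball, and on a ball a bound for a linear map scales to the whole space.
\<close>

lemma banach_steinhaus:
  fixes T :: "'i \<Rightarrow> 'a::banach \<Rightarrow> 'b::real_normed_vector"
  assumes lin: "\<And>i. i \<in> I \<Longrightarrow> bounded_linear (T i)"
    and pointwise: "\<And>x. \<exists>K. \<forall>i\<in>I. norm (T i x) \<le> K"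
  obtains K where "K > 0" "\<And>i x. i \<in> I \<Longrightarrow> norm (T i x) \<le> K * norm x"
proof -
  define U where "U n = (\<Union>i\<in>I. {x. norm (T i x) > real n})" for n
  have op: "open (U n)" for n
    unfolding U_def
    by (intro open_UN ballI open_Collect_less continuous_intros
        linear_continuous_on[OF lin] )
  have "\<exists>n. closure (U n) \<noteq> UNIV"
  proof (rule ccontr)
    assume "\<not> ?thesis"
    then have "Met_TC.mtopology closure_of \<Inter>(range U) = UNIV"
      by (intro Met_TC.metric_Baire_category) (auto simp: op complete_UNIV)
    then have "\<Inter>(range U) \<noteq> {}" by auto
    then obtain x where "x \<in> \<Inter>(range U)" by blast
    then have x: "\<exists>i\<in>I. norm (T i x) > real n" for n by (auto simp: U_def)
    obtain K where "\<forall>i\<in>I. norm (T i x) \<le> K" using pointwise by blast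
    moreover obtain n where "K < real n" using reals_Archimedean2 by blast
    ultimately show False using x[of n] by fastforce
  qed
  then obtain n x where "x \<notin> closure (U n)" by blast
  then obtain e where e: "e > 0" and sep: "\<And>y. dist y x < e \<Longrightarrow> y \<notin> U n"
    unfolding closure_approachable by (metis linorder_not_less order_refl)
  have small: "norm (T i y) \<le> n" if "dist y x < e" "i \<in> I" for i y
    using sep[OF that(1)] that(2) by (force simp: U_def)
  show ?thesis
  proof (rule that)
    show "4 * (real n + 1) / e > 0" using e by simp
    fix i z assume i: "i \<in> I"
    interpret bounded_linear "T i" by (rule lin[OF i])
    show "norm (T i z) \<le> 4 * (real n + 1) / e * norm z"
    proof (cases "z = 0")
      case True
      then show ?thesis by (simp add: zero)
    next
      case False
      define r where "r = e / (2 * norm z)"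
      have r: "r > 0" using e False by (simp add: r_def)
      have "dist (x + r *\<^sub>R z) x < e" using e False by (simp add: dist_norm r_def)
      then have "norm (T i (x + r *\<^sub>R z)) \<le> n" "norm (T i x) \<le> n"
        using small i e by auto
      moreover have "r * norm (T i z) = norm (T i (x + r *\<^sub>R z) - T i x)"
        using r by (simp add: add scaleR)
      ultimately have "r * norm (T i z) \<le> 2 * n"
        using norm_triangle_ineq4[of "T i (x + r *\<^sub>R z)" "T i x"] by linarith
      then have "norm (T i z) \<le> 2 * n / r" using r by (simp add: field_simps)
      also have "\<dots> = 4 * n / e * norm z" by (simp add: r_def)
      also have "\<dots> \<le> 4 * (real n + 1) / e * norm z"
        using e by (intro mult_right_mono divide_right_mono) auto
      finally show ?thesis .
    qed
  qed
qed


section \<open>Spectral measures\<close>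

locale spectral =
  fixes E :: "complex set \<Rightarrow> 'a::complex_banach \<Rightarrow> 'a"
  assumes spectral: "spectral_measure E"
begin

lemma clinear: "\<delta> \<in> sets borel \<Longrightarrow> bounded_clinear (E \<delta>)"
  using spectral unfolding spectral_measure_def by blast

lemma linear: "\<delta> \<in> sets borel \<Longrightarrow> bounded_linear (E \<delta>)"
  using clinear by (rule bounded_clinear_imp_linear)

lemma E_empty [simp]: "E {} x = 0"
  using spectral unfolding spectral_measure_def by blast

lemma E_UNIV [simp]: "E UNIV x = x"
  using spectral unfolding spectral_measure_def by blast

lemma E_E: "\<delta> \<in> sets borel \<Longrightarrow> \<sigma> \<in> sets borel \<Longrightarrow> E \<delta> (E \<sigma> x) = E (\<delta> \<inter> \<sigma>) x"
  using spectral unfolding spectral_measure_def by blast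

lemma E_sums:
  "(\<And>n. \<delta> n \<in> sets borel) \<Longrightarrow> disjoint_family \<delta> \<Longrightarrow>
    (\<lambda>n::nat. E (\<delta> n) x) sums E (\<Union>n. \<delta> n) x"
  using spectral unfolding spectral_measure_def by blast

lemma E_Un:
  assumes "A \<in> sets borel" "B \<in> sets borel" "A \<inter> B = {}"
  shows "E (A \<union> B) x = E A x + E B x"
proof -
  define d where "d n = (if n = 0 then A else if n = Suc 0 then B else {})" for n
  have "(\<lambda>n. E (d n) x) sums E (\<Union>n. d n) x"
    using assms by (intro E_sums) (auto simp: d_def disjoint_family_on_def)
  moreover have "(\<Union>n. d n) = A \<union> B" by (auto simp: d_def split: if_splits)
  moreover have "(\<lambda>n. E (d n) x) sums (\<Sum>n\<in>{0, Suc 0}. E (d n) x)"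
    by (rule sums_finite) (auto simp: d_def)
  ultimately have "E (A \<union> B) x = (\<Sum>n\<in>{0, Suc 0}. E (d n) x)"
    using sums_unique2 by metis
  then show ?thesis by (simp add: d_def)
qed

lemma E_UN:
  assumes "finite I" "\<And>i. i \<in> I \<Longrightarrow> P i \<in> sets borel" "disjoint_family_on P I"
  shows "E (\<Union>i\<in>I. P i) x = (\<Sum>i\<in>I. E (P i) x)"
  using assms
proof (induction I rule: finite_induct)
  case (insert i I)
  have "E (P i \<union> (\<Union>i\<in>I. P i)) x = E (P i) x + E (\<Union>i\<in>I. P i) x"
  proof (rule E_Un)
    show "(\<Union>i\<in>I. P i) \<in> sets borel" using insert by (intro sets.finite_UN) auto
    show "P i \<inter> (\<Union>i\<in>I. P i) = {}" using insert by (fastforce simp: disjoint_family_on_def)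
  qed (use insert in auto)
  then show ?case using insert by (simp add: disjoint_family_on_def)
qed simp

text \<open>
  If the values on subsets of \<open>A\<close> were unbounded, then cutting \<open>A\<close> in two along a subset with a
  large value leaves one part with the same defect, while the other part has a value of norm at
  least \<open>1\<close>. Repetition gives disjoint sets whose values do not tend to \<open>0\<close>, against
  \<open>\<sigma>\<close>-additivity.
\<close>

lemma bounded_pointwise: "\<exists>K. \<forall>\<delta>\<in>sets borel. norm (E \<delta> x) \<le> K"
proof (rule ccontr)
  define unb where "unb A \<longleftrightarrow> A \<in> sets borel \<and>
    (\<forall>K. \<exists>B\<in>sets borel. B \<subseteq> A \<and> norm (E B x) > K)" for A
  assume "\<not> ?thesis"
  then have U: "unb UNIV" by (auto simp: unb_def not_le)
  have step: "\<exists>A'. unb A' \<and> A' \<subseteq> A \<and> norm (E (A - A') x) \<ge> 1" if A: "unb A" for A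
  proof -
    have Ab: "A \<in> sets borel" using A by (simp add: unb_def)
    obtain B where B: "B \<in> sets borel" "B \<subseteq> A" "norm (E B x) > norm (E A x) + 1"
      using A unfolding unb_def by blast
    have "(A - B) \<union> B = A" "(A - B) \<inter> B = {}" using B by auto
    then have "E A x = E (A - B) x + E B x"
      using E_Un[of "A - B" B x] Ab B by simp
    then have AB: "norm (E (A - B) x) \<ge> 1"
      using B(3) norm_triangle_ineq4[of "E A x" "E (A - B) x"] norm_triangle_ineq[of "E (A - B) x" "E B x"]
      by (simp add: algebra_simps)
    show ?thesis
    proof (cases "unb B")
      case True
      then show ?thesis using AB B by blast
    next
      case False
      then obtain K where K: "\<And>C. C \<in> sets borel \<Longrightarrow> C \<subseteq> B \<Longrightarrow> norm (E C x) \<le> K"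
        using B unfolding unb_def by (metis linorder_not_le)
      have "unb (A - B)"
        unfolding unb_def
      proof (intro conjI allI)
        show "A - B \<in> sets borel" using Ab B by simp
        fix L
        obtain C where C: "C \<in> sets borel" "C \<subseteq> A" "norm (E C x) > L + K"
          using A unfolding unb_def by blast
        have "(C - B) \<union> (C \<inter> B) = C" "(C - B) \<inter> (C \<inter> B) = {}" by auto
        then have "E C x = E (C - B) x + E (C \<inter> B) x"
          using E_Un[of "C - B" "C \<inter> B" x] C B by simp
        moreover have "norm (E (C \<inter> B) x) \<le> K" using K C B by simp
        ultimately have "norm (E (C - B) x) > L"
          using C(3) norm_triangle_ineq[of "E (C - B) x" "E (C \<inter> B) x"] by simp
        then show "\<exists>D\<in>sets borel. D \<subseteq> A - B \<and> norm (E D x) > L" using C B by blast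
      qed
      moreover have "A - (A - B) = B" using B by blast
      moreover have "norm (E B x) \<ge> 1" using B(3) norm_ge_zero[of "E A x"] by linarith
      ultimately show ?thesis by (intro exI[of _ "A - B"]) simp
    qed
  qed
  have "\<exists>A. \<forall>n. unb (A n) \<and> A (Suc n) \<subseteq> A n \<and> norm (E (A n - A (Suc n)) x) \<ge> 1"
    by (rule dependent_nat_choice) (use U step in blast)+
  then obtain A where A: "\<And>n::nat. unb (A n)"
      "\<And>n. A (Suc n) \<subseteq> A n \<and> norm (E (A n - A (Suc n)) x) \<ge> 1"
    by blast
  have dec: "A m \<subseteq> A n" if "n \<le> m" for m n
    using lift_Suc_antimono_le[of A] A(2) that by blast
  have "disjoint_family (\<lambda>n. A n - A (Suc n))"
    unfolding disjoint_family_on_def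
  proof (intro ballI impI)
    fix m n :: nat assume "m \<noteq> n"
    then have "Suc m \<le> n \<or> Suc n \<le> m" by linarith
    then show "(A m - A (Suc m)) \<inter> (A n - A (Suc n)) = {}" using dec by blast
  qed
  then have "(\<lambda>n. E (A n - A (Suc n)) x) sums E (\<Union>n. A n - A (Suc n)) x"
    using A(1) by (intro E_sums) (auto simp: unb_def)
  then have "(\<lambda>n. E (A n - A (Suc n)) x) \<longlonglongrightarrow> 0"
    by (intro summable_LIMSEQ_zero sums_summable)
  then have "(\<lambda>n. norm (E (A n - A (Suc n)) x)) \<longlonglongrightarrow> 0" by (rule tendsto_norm_zero)
  then have "\<forall>\<^sub>F n in sequentially. norm (E (A n - A (Suc n)) x) < 1"
    by (rule order_tendstoD) simp
  then obtain n where "norm (E (A n - A (Suc n)) x) < 1"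
    by (auto simp: eventually_sequentially)
  then show False using A(2)[of n] by simp
qed

text \<open>
  The Banach--Steinhaus theorem removes the dependence on \<open>x\<close>, and this makes \<open>\<integral> f dE\<close> a bounded
  operator controlled by the supremum of \<open>f\<close>.
\<close>

lemma uniformly_bounded:
  obtains M where "M > 0" "\<And>\<delta> x. \<delta> \<in> sets borel \<Longrightarrow> norm (E \<delta> x) \<le> M * norm x"
  using banach_steinhaus[of "sets borel" E] linear bounded_pointwise by metis

lemma null_subset:
  "A \<in> sets borel \<Longrightarrow> B \<in> sets borel \<Longrightarrow> A \<subseteq> B \<Longrightarrow> (\<And>x. E B x = 0) \<Longrightarrow> E A x = 0"
  using E_E[of A B x] linear[of A]
  by (simp add: Int_absorb2 bounded_linear.linear linear_0)

lemma null_countable_Union: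
  assumes "countable F" "\<And>U. U \<in> F \<Longrightarrow> U \<in> sets borel" "\<And>U x. U \<in> F \<Longrightarrow> E U x = 0"
  shows "E (\<Union>F) x = 0"
proof (cases "F = {}")
  case False
  then obtain N :: "nat \<Rightarrow> complex set" where N: "range N = F"
    using assms(1) by (metis uncountable_def)
  have Nb: "N n \<in> sets borel" for n using assms(2) N by blast
  have db: "disjointed N n \<in> sets borel" for n
    unfolding disjointed_def using Nb by (intro sets.Diff sets.finite_UN) auto
  have "E (disjointed N n) x = 0" for n
    using null_subset[OF db Nb disjointed_subset] assms(3) N by blast
  moreover have "(\<lambda>n. E (disjointed N n) x) sums E (\<Union>n. disjointed N n) x"
    by (intro E_sums db disjoint_family_disjointed)
  ultimately have "(\<lambda>n. 0) sums E (\<Union>n. N n) x" by (simp add: UN_disjointed_eq)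
  then have "E (\<Union>n. N n) x = 0" using sums_unique2[OF _ sums_zero] by blast
  then show ?thesis using N by simp
qed simp

abbreviation S :: "complex set"
  where "S \<equiv> spectral_support E"

lemma closed_support: "closed S"
  unfolding spectral_support_def by auto

lemma support_borel [measurable]: "S \<in> sets borel"
  using closed_support by (rule borel_closed)

text \<open>
  The complement of the support is a union of open null sets, and by the Lindelof property countably
  many of them suffice.
\<close>

lemma E_support [simp]: "E S x = x"
proof -
  define F where "F = {U. open U \<and> (\<forall>x. E U x = 0)}"
  obtain F' where F': "F' \<subseteq> F" "countable F'" "\<Union>F' = \<Union>F"
    using Lindelof[of F] by (auto simp: F_def)
  have "E (\<Union>F') x = 0"
    using F' by (intro null_countable_Union) (auto simp: F_def)
  then have "E (- S) x = 0" using F' by (simp add: spectral_support_def F_def)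
  then show ?thesis using E_Un[of S "- S" x] by simp
qed

lemma open_meets_support:
  assumes "open U" "U \<inter> S \<noteq> {}"
  obtains x where "E U x \<noteq> 0"
  using assms unfolding spectral_support_def by blast

lemma zero_if_bounded_parts_zero:
  assumes "\<And>\<delta>. \<delta> \<in> sets borel \<Longrightarrow> bounded \<delta> \<Longrightarrow> E \<delta> x = 0"
  shows "x = 0"
proof -
  define N where "N n = cball (0::complex) (real n)" for n
  have db: "disjointed N n \<in> sets borel" for n
    unfolding disjointed_def N_def by (intro sets.Diff sets.finite_UN) auto
  have "bounded (disjointed N n)" for n
    using disjointed_subset[of N n] bounded_subset[of "N n"] by (simp add: N_def)
  then have "E (disjointed N n) x = 0" for n using assms db by blast
  moreover have "(\<lambda>n. E (disjointed N n) x) sums E (\<Union>n. disjointed N n) x"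
    by (intro E_sums db disjoint_family_disjointed)
  moreover have "(\<Union>n. disjointed N n) = UNIV"
    unfolding UN_disjointed_eq N_def using real_arch_simple by fastforce
  ultimately have "(\<lambda>n. 0) sums x" by simp
  then show ?thesis using sums_unique2[OF _ sums_zero] by blast
qed

end

section \<open>Integrals of simple functions\<close>

lemma norm_convex_sum_le:
  fixes v :: "'i \<Rightarrow> 'a::real_normed_vector"
  assumes "finite I" "\<And>i. i \<in> I \<Longrightarrow> 0 \<le> a i \<and> a i \<le> (1::real)"
    and "\<And>J. J \<subseteq> I \<Longrightarrow> norm (w + (\<Sum>i\<in>J. v i)) \<le> K"
  shows "norm (w + (\<Sum>i\<in>I. a i *\<^sub>R v i)) \<le> K"
  using assms
proof (induction I arbitrary: w rule: finite_induct)
  case (insert i I)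
  let ?s = "\<Sum>i\<in>I. a i *\<^sub>R v i"
  have 0: "norm (w + ?s) \<le> K"
    using insert.prems by (intro insert.IH) auto
  have 1: "norm ((w + v i) + ?s) \<le> K"
  proof (rule insert.IH)
    fix J assume J: "J \<subseteq> I"
    then have "i \<notin> J" "finite J" using insert.hyps finite_subset by auto
    then show "norm ((w + v i) + (\<Sum>i\<in>J. v i)) \<le> K"
      using insert.prems(2)[of "insert i J"] J by (auto simp: add.assoc)
  qed (use insert.prems in auto)
  have ai: "0 \<le> a i" "a i \<le> 1" using insert.prems(1) by auto
  have "w + (\<Sum>i\<in>insert i I. a i *\<^sub>R v i) = (1 - a i) *\<^sub>R (w + ?s) + a i *\<^sub>R ((w + v i) + ?s)"
    using insert.hyps by (simp add: algebra_simps)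
  also have "norm \<dots> \<le> (1 - a i) * norm (w + ?s) + a i * norm ((w + v i) + ?s)"
    using norm_triangle_ineq[of "(1 - a i) *\<^sub>R (w + ?s)" "a i *\<^sub>R ((w + v i) + ?s)"] ai by simp
  also have "\<dots> \<le> (1 - a i) * K + a i * K"
    using 0 1 ai by (intro add_mono mult_left_mono) auto
  finally show ?case by (simp add: algebra_simps)
qed simp

text \<open>
  The factor \<open>4\<close> counts the positive and negative parts of the real and imaginary
  parts of the coefficients: for coefficients in \<open>[0, 1]\<close> the sum is a convex combination of
  partial sums of the \<open>v i\<close>.
\<close>

lemma norm_scaleC_sum_le:
  fixes v :: "'i \<Rightarrow> 'a::complex_banach"
  assumes fin: "finite I" and C: "C \<ge> 0" and c: "\<And>i. i \<in> I \<Longrightarrow> cmod (c i) \<le> C"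
    and K: "\<And>J. J \<subseteq> I \<Longrightarrow> norm (\<Sum>i\<in>J. v i) \<le> K"
  shows "norm (\<Sum>i\<in>I. c i *\<^sub>C v i) \<le> 4 * C * K"
proof (cases "C > 0")
  case False
  then have "C = 0" using C by simp
  then show ?thesis using c by simp
next
  case True
  have part: "norm (\<Sum>i\<in>I. (max (f i) 0 / C) *\<^sub>R v i) \<le> K"
    if "\<And>i. i \<in> I \<Longrightarrow> f i \<le> C" for f :: "'i \<Rightarrow> real"
    using norm_convex_sum_le[of I "\<lambda>i. max (f i) 0 / C" 0 v K] fin K that True by simp
  define P where "P f = (\<Sum>i\<in>I. (max (f i) 0 / C) *\<^sub>R v i)" for f
  have cb: "Re (c i) \<le> C" "- Re (c i) \<le> C" "Im (c i) \<le> C" "- Im (c i) \<le> C"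
    if "i \<in> I" for i
    using c[OF that] abs_Re_le_cmod[of "c i"] abs_Im_le_cmod[of "c i"] by linarith+
  have P: "norm (P (\<lambda>i. Re (c i))) \<le> K" "norm (P (\<lambda>i. - Re (c i))) \<le> K"
    "norm (P (\<lambda>i. Im (c i))) \<le> K" "norm (P (\<lambda>i. - Im (c i))) \<le> K"
    unfolding P_def
    using cb by (intro part; simp)+
  have "c i *\<^sub>C v i = C *\<^sub>R ((max (Re (c i)) 0 / C) *\<^sub>R v i - (max (- Re (c i)) 0 / C) *\<^sub>R v i)
      + C *\<^sub>R \<i> *\<^sub>C ((max (Im (c i)) 0 / C) *\<^sub>R v i - (max (- Im (c i)) 0 / C) *\<^sub>R v i)" for i
  proof -
    have pm: "C *\<^sub>R ((max r 0 / C) *\<^sub>R v i - (max (- r) 0 / C) *\<^sub>R v i) = r *\<^sub>R v i" for r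
      using True by (auto simp: max_def scaleR_diff_left[symmetric])
    have "c i *\<^sub>C v i = Re (c i) *\<^sub>R v i + \<i> *\<^sub>C Im (c i) *\<^sub>R v i"
      by (subst complex_eq[of "c i"])
        (simp add: scaleC_add_left flip: scaleC_scaleC scaleC_of_real)
    then show ?thesis by (simp add: pm flip: scaleC.scaleR_right)
  qed
  then have "(\<Sum>i\<in>I. c i *\<^sub>C v i) = C *\<^sub>R (P (\<lambda>i. Re (c i)) - P (\<lambda>i. - Re (c i)))
      + C *\<^sub>R \<i> *\<^sub>C (P (\<lambda>i. Im (c i)) - P (\<lambda>i. - Im (c i)))"
    by (simp add: P_def sum.distrib sum_subtractf flip: scaleR_sum_right scaleC.sum_right)
  also have "norm \<dots> \<le> C * norm (P (\<lambda>i. Re (c i)) - P (\<lambda>i. - Re (c i)))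
      + C * norm (P (\<lambda>i. Im (c i)) - P (\<lambda>i. - Im (c i)))"
    using True by (intro order_trans[OF norm_triangle_ineq]) (simp add: norm_scaleC)
  also have "\<dots> \<le> C * (K + K) + C * (K + K)"
    using P True
    by (intro add_mono mult_left_mono order_trans[OF norm_triangle_ineq4]) auto
  finally show ?thesis by (simp add: algebra_simps)
qed

context spectral
begin

definition E_bound :: real
  where "E_bound = (SOME M. M > 0 \<and> (\<forall>\<delta>\<in>sets borel. \<forall>x. norm (E \<delta> x) \<le> M * norm x))"

lemma E_bound: "E_bound > 0" "\<delta> \<in> sets borel \<Longrightarrow> norm (E \<delta> x) \<le> E_bound * norm x"
proof -
  have "\<exists>M. M > 0 \<and> (\<forall>\<delta>\<in>sets borel. \<forall>x. norm (E \<delta> x) \<le> M * norm x)"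
    using uniformly_bounded by metis
  from someI_ex[OF this] show "E_bound > 0" "\<delta> \<in> sets borel \<Longrightarrow> norm (E \<delta> x) \<le> E_bound * norm x"
    unfolding E_bound_def by blast+
qed

text \<open>
  The weights \<open>w\<close> allow the same partition, given by the level sets of \<open>p\<close>, to serve several
  simple functions \<open>w \<circ> p\<close> at once.
\<close>

definition weighted_integral :: "('b \<Rightarrow> complex) \<Rightarrow> (complex \<Rightarrow> 'b) \<Rightarrow> 'a \<Rightarrow> 'a"
  where "weighted_integral w p x = (\<Sum>c\<in>range p. w c *\<^sub>C E (p -` {c}) x)"

abbreviation simple_integral :: "(complex \<Rightarrow> complex) \<Rightarrow> 'a \<Rightarrow> 'a"
  where "simple_integral \<equiv> weighted_integral (\<lambda>c. c)"

abbreviation simple :: "(complex \<Rightarrow> 'b) \<Rightarrow> bool"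
  where "simple \<equiv> simple_function (borel :: complex measure)"

lemma simple_finite: "simple p \<Longrightarrow> finite (range p)"
  by (simp add: simple_function_def)

lemma simple_level: "simple p \<Longrightarrow> p -` {c} \<in> sets borel"
  using simple_functionD(2)[of borel p "{c}"] by simp

lemma E_levels:
  assumes "simple p" "J \<subseteq> range p"
  shows "(\<Sum>c\<in>J. E (p -` {c}) x) = E (p -` J) x"
proof -
  have "E (\<Union>c\<in>J. p -` {c}) x = (\<Sum>c\<in>J. E (p -` {c}) x)"
    using assms finite_subset[OF _ simple_finite]
    by (intro E_UN) (auto simp: simple_level disjoint_family_on_def)
  moreover have "(\<Union>c\<in>J. p -` {c}) = p -` J" by blast
  ultimately show ?thesis by simp
qed

lemma weighted_integral_compose:
  assumes p: "simple p"
  shows "weighted_integral w (\<lambda>z. u (p z)) x = weighted_integral (\<lambda>c. w (u c)) p x"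
proof -
  have "weighted_integral (\<lambda>c. w (u c)) p x =
      (\<Sum>d\<in>u ` range p. \<Sum>c\<in>{c \<in> range p. u c = d}. w (u c) *\<^sub>C E (p -` {c}) x)"
    unfolding weighted_integral_def by (rule sum.image_gen[OF simple_finite[OF p]])
  also have "\<dots> = (\<Sum>d\<in>u ` range p. w d *\<^sub>C E ((\<lambda>z. u (p z)) -` {d}) x)"
  proof (rule sum.cong[OF refl])
    fix d
    have "(\<Sum>c\<in>{c \<in> range p. u c = d}. w (u c) *\<^sub>C E (p -` {c}) x)
        = w d *\<^sub>C (\<Sum>c\<in>{c \<in> range p. u c = d}. E (p -` {c}) x)"
      by (simp add: scaleC.sum_right)
    also have "(\<Sum>c\<in>{c \<in> range p. u c = d}. E (p -` {c}) x)
        = E (p -` {c \<in> range p. u c = d}) x"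
      by (rule E_levels[OF p]) auto
    also have "p -` {c \<in> range p. u c = d} = (\<lambda>z. u (p z)) -` {d}" by auto
    finally show "(\<Sum>c\<in>{c \<in> range p. u c = d}. w (u c) *\<^sub>C E (p -` {c}) x)
        = w d *\<^sub>C E ((\<lambda>z. u (p z)) -` {d}) x" .
  qed
  finally show ?thesis unfolding weighted_integral_def by (simp add: image_image)
qed

lemma weighted_integral_norm:
  assumes p: "simple p" and C: "\<And>z. cmod (w (p z)) \<le> C"
  shows "norm (weighted_integral w p x) \<le> 4 * E_bound * C * norm x"
proof -
  have "norm (weighted_integral w p x) \<le> 4 * C * (E_bound * norm x)"
    unfolding weighted_integral_def
  proof (rule norm_scaleC_sum_le)
    fix J assume "J \<subseteq> range p"
    then have "(\<Sum>c\<in>J. E (p -` {c}) x) = E (p -` J) x" by (rule E_levels[OF p])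
    moreover have "p -` J \<in> sets borel"
      using simple_functionD(2)[OF p, of J] by simp
    ultimately show "norm (\<Sum>c\<in>J. E (p -` {c}) x) \<le> E_bound * norm x" using E_bound by simp
  qed (use simple_finite[OF p] C order_trans[OF norm_ge_zero C] in auto)
  then show ?thesis by (simp add: ac_simps)
qed

lemma weighted_integral_mult:
  assumes p: "simple p"
  shows "weighted_integral w p (weighted_integral u p x) = weighted_integral (\<lambda>c. w c * u c) p x"
proof -
  have fin: "finite (range p)" by (rule simple_finite[OF p])
  have "E (p -` {c}) (weighted_integral u p x) = u c *\<^sub>C E (p -` {c}) x" if c: "c \<in> range p" for c
  proof -
    interpret bounded_linear "E (p -` {c})" by (rule linear[OF simple_level[OF p]])
    have "E (p -` {c}) (weighted_integral u p x)
        = (\<Sum>d\<in>range p. u d *\<^sub>C E (p -` {c}) (E (p -` {d}) x))"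
      using bounded_clinear_scaleC[OF clinear[OF simple_level[OF p]]]
      by (simp add: weighted_integral_def sum)
    also have "\<dots> = (\<Sum>d\<in>range p. if d = c then u c *\<^sub>C E (p -` {c}) x else 0)"
    proof (rule sum.cong[OF refl])
      fix d
      have "p -` {c} \<inter> p -` {d} = (if d = c then p -` {c} else {})" by auto
      then show "u d *\<^sub>C E (p -` {c}) (E (p -` {d}) x) =
          (if d = c then u c *\<^sub>C E (p -` {c}) x else 0)"
        by (simp add: E_E simple_level[OF p])
    qed
    also have "\<dots> = u c *\<^sub>C E (p -` {c}) x" using fin c by simp
    finally show ?thesis .
  qed
  then show ?thesis
    unfolding weighted_integral_def[of w] weighted_integral_def[of "\<lambda>c. w c * u c"]
    by (intro sum.cong refl) (simp add: scaleC_scaleC)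
qed

text \<open>
  Every algebraic rule for two simple functions \<open>s\<close>, \<open>t\<close> is read off on the partition given by
  the pair \<open>(s, t)\<close>.
\<close>

lemma simple_integral_pair:
  assumes "simple s" "simple t"
  shows "simple_integral (\<lambda>z. u (s z) (t z)) x = weighted_integral (\<lambda>q. u (fst q) (snd q)) (\<lambda>z. (s z, t z)) x"
  using weighted_integral_compose[of "\<lambda>z. (s z, t z)" "\<lambda>c. c" "\<lambda>q. u (fst q) (snd q)" x] assms
  by (simp add: simple_function_Pair)

lemma simple_integral_mult:
  assumes "simple s" "simple t"
  shows "simple_integral s (simple_integral t x) = simple_integral (\<lambda>z. s z * t z) x"
  using simple_integral_pair[OF assms, of "\<lambda>a b. a"] simple_integral_pair[OF assms, of "\<lambda>a b. b"]
    simple_integral_pair[OF assms, of "\<lambda>a b. a * b"] weighted_integral_mult[OF simple_function_Pair[OF assms]]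
  by simp

lemma simple_integral_diff:
  assumes "simple s" "simple t"
  shows "simple_integral (\<lambda>z. s z - t z) x = simple_integral s x - simple_integral t x"
  using simple_integral_pair[OF assms, of "\<lambda>a b. a"] simple_integral_pair[OF assms, of "\<lambda>a b. b"]
    simple_integral_pair[OF assms, of "\<lambda>a b. a - b"]
  by (simp add: weighted_integral_def scaleC.diff_left sum_subtractf)

lemma simple_integral_add:
  assumes "simple s" "simple t"
  shows "simple_integral (\<lambda>z. s z + t z) x = simple_integral s x + simple_integral t x"
  using simple_integral_pair[OF assms, of "\<lambda>a b. a"] simple_integral_pair[OF assms, of "\<lambda>a b. b"]
    simple_integral_pair[OF assms, of "\<lambda>a b. a + b"]
  by (simp add: weighted_integral_def scaleC.add_left sum.distrib)

lemma simple_integral_indicator: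
  assumes "\<delta> \<in> sets borel"
  shows "simple_integral (indicator \<delta>) x = E \<delta> x"
proof -
  have s: "simple (\<lambda>z. z \<in> \<delta>)"
    using assms by (intro simple_function_eq_measurable[THEN iffD2]) (auto intro: finite_subset[of _ UNIV])
  have "simple_integral (\<lambda>z. if z \<in> \<delta> then 1 else 0) x = weighted_integral (\<lambda>b. if b then 1 else 0) (\<lambda>z. z \<in> \<delta>) x"
    using weighted_integral_compose[OF s, of "\<lambda>c. c" "\<lambda>b. if b then 1 else 0"] by simp
  also have "\<dots> = (\<Sum>b\<in>UNIV. (if b then 1 else 0) *\<^sub>C E ((\<lambda>z. z \<in> \<delta>) -` {b}) x)"
    unfolding weighted_integral_def
  proof (rule sum.mono_neutral_left)
    show "\<forall>b\<in>UNIV - range (\<lambda>z. z \<in> \<delta>). (if b then 1 else 0) *\<^sub>C E ((\<lambda>z. z \<in> \<delta>) -` {b}) x = 0"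
    proof
      fix b assume "b \<in> UNIV - range (\<lambda>z. z \<in> \<delta>)"
      then have "(\<lambda>z. z \<in> \<delta>) -` {b} = {}" by auto
      then show "(if b then 1 else 0) *\<^sub>C E ((\<lambda>z. z \<in> \<delta>) -` {b}) x = 0" by simp
    qed
  qed auto
  also have "\<dots> = E ((\<lambda>z. z \<in> \<delta>) -` {True}) x" by (simp add: UNIV_bool)
  also have "(\<lambda>z. z \<in> \<delta>) -` {True} = \<delta>" by auto
  finally show ?thesis by (simp add: indicator_def[abs_def] of_bool_def)
qed

lemma simple_integral_linear:
  assumes "simple s"
  shows "bounded_linear (simple_integral s)"
  unfolding weighted_integral_def
  by (intro bounded_linear_sum bounded_linear_compose[OF scaleC.bounded_linear_right]
      linear simple_level[OF assms])


section \<open>The functional calculus for bounded Borel functions\<close>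

definition bborel :: "(complex \<Rightarrow> complex) \<Rightarrow> bool"
  where "bborel f \<longleftrightarrow> f \<in> borel_measurable borel \<and> (\<exists>C. \<forall>z. cmod (f z) \<le> C)"

lemma bborelI: "f \<in> borel_measurable borel \<Longrightarrow> (\<And>z. cmod (f z) \<le> C) \<Longrightarrow> bborel f"
  unfolding bborel_def by blast

lemma bborel_measurable: "bborel f \<Longrightarrow> f \<in> borel_measurable borel"
  unfolding bborel_def by blast

lemma bborel_add: assumes "bborel f" "bborel g" shows "bborel (\<lambda>z. f z + g z)"
proof -
  obtain C D where "\<And>z. cmod (f z) \<le> C" "\<And>z. cmod (g z) \<le> D" using assms by (auto simp: bborel_def)
  then have "cmod (f z + g z) \<le> C + D" for z by (intro norm_triangle_mono)
  then show ?thesis using assms by (intro bborelI) (auto simp: bborel_def)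
qed

lemma bborel_mult: assumes "bborel f" "bborel g" shows "bborel (\<lambda>z. f z * g z)"
proof -
  obtain C D where "\<And>z. cmod (f z) \<le> C" "\<And>z. cmod (g z) \<le> D" using assms by (auto simp: bborel_def)
  then have "cmod (f z * g z) \<le> C * D" for z
    using order_trans[OF norm_ge_zero, of "f 0" C] by (auto simp: norm_mult intro!: mult_mono intro: order_trans[OF norm_ge_zero])
  then show ?thesis using assms by (intro bborelI) (auto simp: bborel_def)
qed

lemma bborel_const: "bborel (\<lambda>_. c)"
  by (rule bborelI[of _ "cmod c"]) auto

lemma bborel_indicator: "\<delta> \<in> sets borel \<Longrightarrow> bborel (indicator \<delta>)"
  by (rule bborelI[of _ 1]) (auto simp: indicator_def)

lemma bborel_simple: assumes "simple s" shows "bborel s"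
proof (rule bborelI)
  show "s \<in> borel_measurable borel" using assms by (rule borel_measurable_simple_function)
  show "cmod (s z) \<le> (\<Sum>c\<in>range s. cmod c)" for z
    using simple_finite[OF assms] by (intro member_le_sum) auto
qed

text \<open>
  Real and imaginary parts are rounded down to multiples of \<open>1 / (n + 1)\<close>; boundedness leaves
  finitely many values.
\<close>

lemma bborel_approx:
  assumes "bborel f"
  obtains s where "\<And>n::nat. simple (s n)" "uniform_limit UNIV s f sequentially"
proof -
  obtain C where C: "\<And>z. cmod (f z) \<le> C" using assms by (auto simp: bborel_def)
  define rd where "rd n r = real_of_int \<lfloor>r * (real n + 1)\<rfloor> / (real n + 1)" for n and r :: real
  have rd: "\<bar>rd n r - r\<bar> \<le> 1 / (real n + 1)" for n r
  proof -
    have "\<bar>real_of_int \<lfloor>r * (real n + 1)\<rfloor> - r * (real n + 1)\<bar> \<le> 1" by linarith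
    moreover have "rd n r - r = (real_of_int \<lfloor>r * (real n + 1)\<rfloor> - r * (real n + 1)) / (real n + 1)"
      unfolding rd_def diff_divide_distrib by simp
    ultimately show ?thesis by (simp add: abs_divide divide_right_mono)
  qed
  define s where "s n z = Complex (rd n (Re (f z))) (rd n (Im (f z)))" for n z
  have fm [measurable]: "f \<in> borel_measurable borel" using assms by (rule bborel_measurable)
  have fin: "finite ((\<lambda>r. rd n r) ` {-C..C})" for n
  proof -
    have "(\<lambda>r. rd n r) ` {-C..C} \<subseteq> (\<lambda>k. real_of_int k / (real n + 1)) `
        {\<lfloor>- C * (real n + 1)\<rfloor>..\<lfloor>C * (real n + 1)\<rfloor>}"
    proof
      fix y assume "y \<in> (\<lambda>r. rd n r) ` {-C..C}"
      then obtain r where r: "- C \<le> r" "r \<le> C" "y = rd n r" by auto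
      then have "- C * (real n + 1) \<le> r * (real n + 1)" "r * (real n + 1) \<le> C * (real n + 1)"
        by (intro mult_right_mono; simp)+
      then have "\<lfloor>r * (real n + 1)\<rfloor> \<in> {\<lfloor>- C * (real n + 1)\<rfloor>..\<lfloor>C * (real n + 1)\<rfloor>}"
        by (simp only: atLeastAtMost_iff floor_mono)
      then show "y \<in> (\<lambda>k. real_of_int k / (real n + 1)) `
          {\<lfloor>- C * (real n + 1)\<rfloor>..\<lfloor>C * (real n + 1)\<rfloor>}"
        using r(3) by (auto simp: rd_def)
    qed
    then show ?thesis by (rule finite_subset) simp
  qed
  have inC: "Re (f z) \<in> {-C..C}" "Im (f z) \<in> {-C..C}" for z
    using C[of z] abs_Re_le_cmod[of "f z"] abs_Im_le_cmod[of "f z"] by auto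
  have "simple (s n)" for n
  proof (rule simple_function_borel_measurable)
    have "range (s n) \<subseteq> (\<lambda>(a, b). Complex a b) `
        ((\<lambda>r. rd n r) ` {-C..C} \<times> (\<lambda>r. rd n r) ` {-C..C})"
      using inC by (auto simp: s_def)
    then have "finite (range (s n))"
      by (rule finite_subset) (intro finite_imageI finite_cartesian_product fin)
    then show "finite (s n ` space borel)" by simp
    have fl: "(\<lambda>r. rd n r) \<in> borel_measurable borel" unfolding rd_def by measurable
    have "(\<lambda>z. complex_of_real (rd n (Re (f z))) + \<i> * complex_of_real (rd n (Im (f z))))
        \<in> borel_measurable borel"
      using fl by measurable
    then show "s n \<in> borel_measurable borel"
      by (simp add: s_def[abs_def] Complex_eq)
  qed
  moreover have "uniform_limit UNIV s f sequentially"
  proof (rule uniform_limitI)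
    fix e :: real assume e: "e > 0"
    have "(\<lambda>n. 2 * (1 / (real n + 1))) \<longlonglongrightarrow> 2 * 0"
      using LIMSEQ_inverse_real_of_nat by (intro tendsto_mult_left) (simp add: inverse_eq_divide add.commute)
    then have "(\<lambda>n. 2 / (real n + 1)) \<longlonglongrightarrow> 0" by simp
    then have "\<forall>\<^sub>F n in sequentially. 2 / (real n + 1) < e" using e by (rule order_tendstoD)
    then show "\<forall>\<^sub>F n in sequentially. \<forall>z\<in>UNIV. dist (s n z) (f z) < e"
    proof eventually_elim
      case (elim n)
      have "cmod (s n z - f z) \<le> \<bar>rd n (Re (f z)) - Re (f z)\<bar> + \<bar>rd n (Im (f z)) - Im (f z)\<bar>" for z
        using cmod_le[of "s n z - f z"] by (simp add: s_def)
      then have "dist (s n z) (f z) \<le> 1 / (real n + 1) + 1 / (real n + 1)" for z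
        using rd[of n "Re (f z)"] rd[of n "Im (f z)"] unfolding dist_norm
        by (meson add_mono order_trans)
      then show ?case using elim by (auto intro: le_less_trans)
    qed
  qed
  ultimately show ?thesis using that by blast
qed

text \<open>
  Uniformly close simple functions have close integrals, so the limit over an approximating sequence
  exists and does not depend on the sequence.
\<close>

lemma simple_integral_uniform_tendsto:
  assumes s: "\<And>n. simple (s n)" and t: "\<And>n. simple (t n)"
    and "uniform_limit UNIV s f sequentially" "uniform_limit UNIV t f sequentially"
  shows "(\<lambda>n. simple_integral (s n) x - simple_integral (t n) x) \<longlonglongrightarrow> 0"
proof (rule tendstoI)
  fix e :: real assume e: "e > 0"
  define d where "d = e / (8 * E_bound * (norm x + 1))"
  have x: "norm x + 1 > 0" using norm_ge_zero[of x] by linarith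
  have d: "d > 0" using e E_bound(1) x by (simp add: d_def)
  have "\<forall>\<^sub>F n in sequentially. \<forall>z\<in>UNIV. dist (s n z) (f z) < d"
    "\<forall>\<^sub>F n in sequentially. \<forall>z\<in>UNIV. dist (t n z) (f z) < d"
    using uniform_limitD[OF assms(3) d] uniform_limitD[OF assms(4) d] by auto
  then show "\<forall>\<^sub>F n in sequentially. dist (simple_integral (s n) x - simple_integral (t n) x) 0 < e"
  proof eventually_elim
    case (elim n)
    have st: "cmod (s n z - t n z) \<le> 2 * d" for z
    proof -
      have "dist (s n z) (f z) < d" "dist (t n z) (f z) < d" using elim by blast+
      then show ?thesis using dist_triangle2[of "s n z" "t n z" "f z"] by (simp add: dist_norm)
    qed
    have "norm (simple_integral (s n) x - simple_integral (t n) x) = norm (simple_integral (\<lambda>z. s n z - t n z) x)"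
      by (simp add: simple_integral_diff s t)
    also have "\<dots> \<le> 4 * E_bound * (2 * d) * norm x"
      using st by (intro weighted_integral_norm simple_function_diff s t)
    also have "\<dots> < 8 * E_bound * d * (norm x + 1)" using E_bound(1) d by simp
    also have "\<dots> = e" using E_bound(1) x by (simp add: d_def)
    finally show ?case by (simp add: dist_norm)
  qed
qed

lemma simple_integral_uniform_convergent:
  assumes s: "\<And>n. simple (s n)" and lim: "uniform_limit UNIV s f sequentially"
  shows "convergent (\<lambda>n. simple_integral (s n) x)"
proof (rule ccontr)
  assume "\<not> ?thesis"
  then have "\<not> Cauchy (\<lambda>n. simple_integral (s n) x)" using Cauchy_convergent by blast
  then obtain e where e: "e > 0"
    and far: "\<And>M. \<exists>m\<ge>M. \<exists>n\<ge>M. dist (simple_integral (s m) x) (simple_integral (s n) x) \<ge> e"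
    unfolding Cauchy_def by (meson linorder_not_less)
  have "\<exists>p. fst p \<ge> M \<and> snd p \<ge> M \<and> dist (simple_integral (s (fst p)) x) (simple_integral (s (snd p)) x) \<ge> e" for M
    using far[of M] by auto
  then obtain p where p: "\<And>M. fst (p M) \<ge> M" "\<And>M. snd (p M) \<ge> M"
    and pe: "\<And>M. dist (simple_integral (s (fst (p M))) x) (simple_integral (s (snd (p M))) x) \<ge> e"
    by metis
  have sub: "uniform_limit UNIV (\<lambda>n. s (k n)) f sequentially" if "\<And>n. k n \<ge> n" for k
  proof (rule uniform_limitI)
    fix e :: real assume "e > 0"
    from uniform_limitD[OF lim this] obtain N where
      "\<And>n. n \<ge> N \<Longrightarrow> \<forall>z\<in>UNIV. dist (s n z) (f z) < e"
      by (auto simp: eventually_sequentially)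
    then show "\<forall>\<^sub>F n in sequentially. \<forall>z\<in>UNIV. dist (s (k n) z) (f z) < e"
      using that by (auto simp: eventually_sequentially intro!: exI[of _ N] intro: order_trans)
  qed
  have "(\<lambda>n. simple_integral (s (fst (p n))) x - simple_integral (s (snd (p n))) x) \<longlonglongrightarrow> 0"
    by (intro simple_integral_uniform_tendsto[where f = f] s sub p)
  from tendstoD[OF this e] obtain n where "dist (simple_integral (s (fst (p n))) x - simple_integral (s (snd (p n))) x) 0 < e"
    by (auto simp: eventually_sequentially)
  then show False using pe[of n] by (simp add: dist_norm)
qed

definition bborel_integral :: "(complex \<Rightarrow> complex) \<Rightarrow> 'a \<Rightarrow> 'a"
  where "bborel_integral f x = (THE y. \<forall>s. (\<forall>n. simple (s n)) \<longrightarrow> uniform_limit UNIV s f sequentially \<longrightarrow>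
    (\<lambda>n. simple_integral (s n) x) \<longlonglongrightarrow> y)"

lemma bborel_integral_lim:
  assumes f: "bborel f" and s: "\<And>n. simple (s n)" "uniform_limit UNIV s f sequentially"
  shows "(\<lambda>n. simple_integral (s n) x) \<longlonglongrightarrow> bborel_integral f x"
proof -
  obtain y where y: "(\<lambda>n. simple_integral (s n) x) \<longlonglongrightarrow> y"
    using simple_integral_uniform_convergent[OF s] by (auto simp: convergent_def)
  have all: "(\<lambda>n. simple_integral (t n) x) \<longlonglongrightarrow> y"
    if t: "\<forall>n. simple (t n)" "uniform_limit UNIV t f sequentially" for t
    using tendsto_diff[OF y simple_integral_uniform_tendsto[OF s(1) _ s(2) t(2), of x]] t(1) by simp
  have "bborel_integral f x = y"
    unfolding bborel_integral_def
    using all s LIMSEQ_unique[OF y] by (intro the_equality) blast+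
  then show ?thesis using y by simp
qed

lemma bborel_integral_simple:
  assumes "simple s"
  shows "bborel_integral s x = simple_integral s x"
proof -
  have "(\<lambda>n::nat. simple_integral s x) \<longlonglongrightarrow> bborel_integral s x"
    by (rule bborel_integral_lim[OF bborel_simple[OF assms] assms]) (simp add: uniform_limit_iff)
  then show ?thesis using LIMSEQ_unique tendsto_const by blast
qed

lemma bborel_integral_norm:
  assumes "bborel f" and C: "\<And>z. cmod (f z) \<le> C"
  shows "norm (bborel_integral f x) \<le> 4 * E_bound * C * norm x"
proof (rule field_le_epsilon)
  fix e :: real assume e: "e > 0"
  define d where "d = e / (4 * E_bound * (norm x + 1))"
  have x: "norm x + 1 > 0" using norm_ge_zero[of x] by linarith
  have d: "d > 0" using e E_bound(1) x by (simp add: d_def)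
  obtain s where s: "\<And>n. simple (s n)" "uniform_limit UNIV s f sequentially"
    using bborel_approx[OF assms(1)] by blast
  have "\<forall>\<^sub>F n in sequentially. norm (simple_integral (s n) x) \<le> 4 * E_bound * (C + d) * norm x"
    using uniform_limitD[OF s(2) d]
  proof eventually_elim
    case (elim n)
    have "cmod (s n z) \<le> C + d" for z
    proof -
      have "dist (s n z) (f z) < d" using elim by blast
      then show ?thesis
        using C[of z] norm_triangle_ineq[of "s n z - f z" "f z"] by (simp add: dist_norm)
    qed
    then show ?case by (intro weighted_integral_norm s)
  qed
  then have "norm (bborel_integral f x) \<le> 4 * E_bound * (C + d) * norm x"
    using tendsto_norm[OF bborel_integral_lim[OF assms(1) s]] by (intro tendsto_upperbound) auto
  also have "\<dots> \<le> 4 * E_bound * C * norm x + 4 * E_bound * d * (norm x + 1)"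
    using E_bound(1) d by (simp add: algebra_simps)
  also have "4 * E_bound * d * (norm x + 1) = e" using E_bound(1) x by (simp add: d_def)
  finally show "norm (bborel_integral f x) \<le> 4 * E_bound * C * norm x + e" .
qed

lemma bborel_integral_linear:
  assumes f: "bborel f"
  shows "bounded_linear (bborel_integral f)"
proof -
  obtain C where C: "\<And>z. cmod (f z) \<le> C" using f by (auto simp: bborel_def)
  obtain s where s: "\<And>n. simple (s n)" "uniform_limit UNIV s f sequentially"
    using bborel_approx[OF f] by blast
  note lim = bborel_integral_lim[OF f s]
  have lin: "linear (simple_integral (s n))" for n
    by (intro bounded_linear.linear simple_integral_linear s)
  show ?thesis
  proof (rule bounded_linear_intro[of _ "4 * E_bound * C"])
    fix x y
    have "(\<lambda>n. simple_integral (s n) (x + y)) \<longlonglongrightarrow> bborel_integral f x + bborel_integral f y"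
      using tendsto_add[OF lim[of x] lim[of y]] by (simp add: linear_add[OF lin])
    then show "bborel_integral f (x + y) = bborel_integral f x + bborel_integral f y" using LIMSEQ_unique lim by blast
  next
    fix r :: real and x
    have "(\<lambda>n. simple_integral (s n) (r *\<^sub>R x)) \<longlonglongrightarrow> r *\<^sub>R bborel_integral f x"
      using tendsto_scaleR[OF tendsto_const lim[of x]] by (simp add: linear_scale[OF lin])
    then show "bborel_integral f (r *\<^sub>R x) = r *\<^sub>R bborel_integral f x" using LIMSEQ_unique lim by blast
  next
    fix x show "norm (bborel_integral f x) \<le> norm x * (4 * E_bound * C)"
      using bborel_integral_norm[OF f C, of x] by (simp add: mult.commute)
  qed
qed

text \<open>The operator \<open>\<integral> f dE\<close>, bundled as a bounded linear map so that operator norms apply.\<close>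

definition Phi :: "(complex \<Rightarrow> complex) \<Rightarrow> 'a \<Rightarrow>\<^sub>L 'a"
  where "Phi f = Blinfun (bborel_integral f)"

lemma Phi_apply: "bborel f \<Longrightarrow> blinfun_apply (Phi f) = bborel_integral f"
  unfolding Phi_def by (rule bounded_linear_Blinfun_apply[OF bborel_integral_linear])

lemma Phi_lim:
  "bborel f \<Longrightarrow> (\<And>n. simple (s n)) \<Longrightarrow> uniform_limit UNIV s f sequentially \<Longrightarrow>
    (\<lambda>n. simple_integral (s n) x) \<longlonglongrightarrow> Phi f x"
  by (simp add: Phi_apply bborel_integral_lim)

lemma Phi_norm:
  assumes "bborel f" "\<And>z. cmod (f z) \<le> C"
  shows "norm (Phi f) \<le> 4 * E_bound * C"
proof (rule norm_blinfun_bound)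
  show "0 \<le> 4 * E_bound * C"
    using E_bound(1) order_trans[OF norm_ge_zero assms(2)] by simp
qed (simp add: Phi_apply assms bborel_integral_norm)

lemma Phi_indicator:
  assumes "\<delta> \<in> sets borel"
  shows "Phi (indicator \<delta>) x = E \<delta> x"
proof -
  have "simple (indicator \<delta>)" using assms by (intro simple_function_indicator) simp
  then show ?thesis
    by (simp add: Phi_apply bborel_indicator assms bborel_integral_simple simple_integral_indicator)
qed

lemma Phi_add:
  assumes f: "bborel f" and g: "bborel g"
  shows "Phi (\<lambda>z. f z + g z) = Phi f + Phi g"
proof (rule blinfun_eqI)
  fix x
  obtain s where s: "\<And>n. simple (s n)" "uniform_limit UNIV s f sequentially"
    using bborel_approx[OF f] by blast
  obtain t where t: "\<And>n. simple (t n)" "uniform_limit UNIV t g sequentially"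
    using bborel_approx[OF g] by blast
  have "(\<lambda>n. simple_integral (\<lambda>z. s n z + t n z) x) \<longlonglongrightarrow> Phi (\<lambda>z. f z + g z) x"
    by (intro Phi_lim bborel_add f g simple_function_add s t uniform_limit_add)
  moreover have "(\<lambda>n. simple_integral (s n) x + simple_integral (t n) x) \<longlonglongrightarrow> Phi f x + Phi g x"
    by (intro tendsto_add Phi_lim f g s t)
  ultimately have "Phi (\<lambda>z. f z + g z) x = Phi f x + Phi g x"
    using LIMSEQ_unique by (simp add: simple_integral_add s t)
  then show "Phi (\<lambda>z. f z + g z) x = (Phi f + Phi g) x"
    by (simp add: blinfun.add_left)
qed

text \<open>
  Multiplicativity passes from simple functions to limits one factor at a time.
\<close>

lemma Phi_mult:
  assumes f: "bborel f" and g: "bborel g"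
  shows "Phi f (Phi g x) = Phi (\<lambda>z. f z * g z) x"
proof -
  obtain s where s: "\<And>n. simple (s n)" "uniform_limit UNIV s f sequentially"
    using bborel_approx[OF f] by blast
  obtain t where t: "\<And>n. simple (t n)" "uniform_limit UNIV t g sequentially"
    using bborel_approx[OF g] by blast
  have bdd: "bounded (h ` UNIV)" if "bborel h" for h :: "complex \<Rightarrow> complex"
    using that by (auto simp: bborel_def bounded_iff)
  have one: "simple_integral (s m) (Phi g x) = Phi (\<lambda>z. s m z * g z) x" for m
  proof -
    have "(\<lambda>n. simple_integral (s m) (simple_integral (t n) x)) \<longlonglongrightarrow> simple_integral (s m) (Phi g x)"
      by (intro bounded_linear.tendsto[OF simple_integral_linear[OF s(1)]] Phi_lim g t)
    moreover have "(\<lambda>n. simple_integral (\<lambda>z. s m z * t n z) x) \<longlonglongrightarrow> Phi (\<lambda>z. s m z * g z) x"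
    proof (intro Phi_lim bborel_mult[OF bborel_simple[OF s(1)] g] s simple_function_mult t)
      show "uniform_limit UNIV (\<lambda>n z. s m z * t n z) (\<lambda>z. s m z * g z) sequentially"
        by (rule bounded_bilinear.bounded_uniform_limit[OF bounded_bilinear_mult uniform_limit_const t(2)
              bdd[OF g] bdd[OF bborel_simple[OF s(1)]]])
    qed
    ultimately show ?thesis using LIMSEQ_unique by (simp add: simple_integral_mult s t)
  qed
  obtain D where D: "\<And>z. cmod (g z) \<le> D" using g by (auto simp: bborel_def)
  have bsg: "bborel (\<lambda>z. s n z * g z)" for n by (intro bborel_mult bborel_simple s g)
  have "(\<lambda>n. norm (Phi (\<lambda>z. s n z * g z) - Phi (\<lambda>z. f z * g z))) \<longlonglongrightarrow> 0"
  proof (rule tendstoI)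
    fix e :: real assume e: "e > 0"
    define d where "d = e / (8 * E_bound * (D + 1))"
    have D0: "D \<ge> 0" using D[of 0] order_trans[OF norm_ge_zero] by blast
    have d: "d > 0" using e E_bound(1) D0 by (simp add: d_def)
    show "\<forall>\<^sub>F n in sequentially. dist (norm (Phi (\<lambda>z. s n z * g z) - Phi (\<lambda>z. f z * g z))) 0 < e"
      using uniform_limitD[OF s(2) d]
    proof eventually_elim
      case (elim n)
      have bd: "bborel (\<lambda>z. (s n z + (- 1) * f z) * g z)"
        by (intro bborel_mult bborel_add bborel_const f g bborel_simple s)
      have "Phi (\<lambda>z. s n z * g z) = Phi (\<lambda>z. (s n z + (- 1) * f z) * g z + f z * g z)"
        by (simp add: algebra_simps)
      also have "\<dots> = Phi (\<lambda>z. (s n z + (- 1) * f z) * g z) + Phi (\<lambda>z. f z * g z)"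
        by (intro Phi_add bd bborel_mult f g)
      finally have "norm (Phi (\<lambda>z. s n z * g z) - Phi (\<lambda>z. f z * g z))
          = norm (Phi (\<lambda>z. (s n z + (- 1) * f z) * g z))" by simp
      also have "\<dots> \<le> 4 * E_bound * (d * D)"
      proof (rule Phi_norm[OF bd])
        fix z
        have "dist (s n z) (f z) < d" using elim by blast
        then have "cmod (s n z + (- 1) * f z) \<le> d" by (simp add: dist_norm)
        then show "cmod ((s n z + (- 1) * f z) * g z) \<le> d * D"
          unfolding norm_mult using D[of z] d by (intro mult_mono) auto
      qed
      also have "\<dots> < 8 * E_bound * d * (D + 1)"
      proof -
        have "E_bound * d > 0" using E_bound(1) d by simp
        moreover have "0 \<le> E_bound * d * D" using E_bound(1) d D0 by simp
        ultimately show ?thesis by (simp add: algebra_simps)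
      qed
      also have "\<dots> = e" using E_bound(1) D0 by (simp add: d_def)
      finally show ?case by simp
    qed
  qed
  then have "(\<lambda>n. Phi (\<lambda>z. s n z * g z)) \<longlonglongrightarrow> Phi (\<lambda>z. f z * g z)"
    by (rule LIM_zero_cancel[OF tendsto_norm_zero_cancel])
  then have "(\<lambda>n. Phi (\<lambda>z. s n z * g z) x) \<longlonglongrightarrow> Phi (\<lambda>z. f z * g z) x"
    by (intro tendsto_intros)
  moreover have "(\<lambda>n. simple_integral (s n) (Phi g x)) \<longlonglongrightarrow> Phi f (Phi g x)"
    by (intro Phi_lim f s)
  ultimately show ?thesis using LIMSEQ_unique one by simp
qed

lemma Phi_const: "Phi (\<lambda>_. c) x = c *\<^sub>C x"
  using bborel_integral_simple[OF simple_function_const, of c x]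
  by (simp add: Phi_apply bborel_const weighted_integral_def vimage_def)

lemma Phi_cmult: "bborel f \<Longrightarrow> Phi (\<lambda>z. c * f z) x = c *\<^sub>C Phi f x"
  using Phi_mult[OF bborel_const, of f c x] by (simp add: Phi_const)

lemma Phi_diff:
  assumes "bborel f" "bborel g"
  shows "bborel (\<lambda>z. f z - g z)" "Phi (\<lambda>z. f z - g z) = Phi f - Phi g"
proof -
  show d: "bborel (\<lambda>z. f z - g z)"
    using bborel_add[OF assms(1) bborel_mult[OF bborel_const assms(2), of "- 1"]] by simp
  show "Phi (\<lambda>z. f z - g z) = Phi f - Phi g"
    using Phi_add[OF d assms(2)] by simp
qed

lemma Phi_scaleR: "bborel f \<Longrightarrow> Phi (\<lambda>z. complex_of_real r * f z) = r *\<^sub>R Phi f"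
  by (rule blinfun_eqI) (simp add: Phi_cmult scaleC_of_real blinfun.scaleR_left)

lemma Phi_scaleC: "bborel f \<Longrightarrow> Phi f (c *\<^sub>C x) = c *\<^sub>C Phi f x"
  using Phi_mult[OF _ bborel_const, of f c x] Phi_cmult[of f c x]
  by (simp add: Phi_const mult.commute)

lemma Phi_clinear: "bborel f \<Longrightarrow> bounded_clinear (blinfun_apply (Phi f))"
  unfolding bounded_clinear_def by (simp add: Phi_scaleC blinfun.bounded_linear_right)

text \<open>
  As \<open>E S\<close> is the identity, integrands may be cut off outside \<open>S\<close>; estimates of exponentials come
  from the shape of the spectrum and hold only there.
\<close>

lemma Phi_support: 
  assumes "bborel f"
  shows "Phi (\<lambda>z. indicator S z * f z) x = Phi f x"
  using Phi_mult[OF bborel_indicator[OF support_borel] assms, of x] by (simp add: Phi_indicator)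

text \<open>
  The integral over \<open>\<delta>\<close> is the integral of the function cut off outside \<open>\<delta>\<close>: the sums over
  \<open>\<delta>\<close> are the full sums applied to \<open>E \<delta> x\<close>.
\<close>

lemma spectral_integral_eq:
  assumes \<delta>: "\<delta> \<in> sets borel" and f: "bborel (\<lambda>z. indicator \<delta> z * f z)"
  shows "spectral_integral E \<delta> f x = Phi (\<lambda>z. indicator \<delta> z * f z) x"
proof -
  let ?Q = "\<lambda>s y. (\<forall>n. simple (s n)) \<and> uniform_limit \<delta> s f sequentially \<and>
      (\<lambda>n::nat. \<Sum>c\<in>range (s n). c *\<^sub>C E (s n -` {c} \<inter> \<delta>) x) \<longlonglongrightarrow> y"
  have si: "simple (indicator \<delta> :: complex \<Rightarrow> complex)"
    using \<delta> by (intro simple_function_indicator) simp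
  have lim: "(\<lambda>n. \<Sum>c\<in>range (s n). c *\<^sub>C E (s n -` {c} \<inter> \<delta>) x) \<longlonglongrightarrow> Phi (\<lambda>z. indicator \<delta> z * f z) x"
    if s: "\<forall>n. simple (s n)" "uniform_limit \<delta> s f sequentially" for s
  proof -
    have "(\<Sum>c\<in>range (s n). c *\<^sub>C E (s n -` {c} \<inter> \<delta>) x) = simple_integral (\<lambda>z. indicator \<delta> z * s n z) x" for n
    proof -
      have "(\<Sum>c\<in>range (s n). c *\<^sub>C E (s n -` {c} \<inter> \<delta>) x) = simple_integral (s n) (simple_integral (indicator \<delta>) x)"
        using s(1) by (simp add: weighted_integral_def[of _ "s n"] simple_integral_indicator \<delta> E_E simple_level)
      also have "\<dots> = simple_integral (\<lambda>z. indicator \<delta> z * s n z) x"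
        using s(1) by (simp add: simple_integral_mult si mult.commute)
      finally show ?thesis .
    qed
    moreover have "(\<lambda>n. simple_integral (\<lambda>z. indicator \<delta> z * s n z) x) \<longlonglongrightarrow> Phi (\<lambda>z. indicator \<delta> z * f z) x"
    proof (rule Phi_lim[OF f])
      show "simple (\<lambda>z. indicator \<delta> z * s n z)" for n
        using s(1) by (intro simple_function_mult si) auto
      show "uniform_limit UNIV (\<lambda>n z. indicator \<delta> z * s n z) (\<lambda>z. indicator \<delta> z * f z) sequentially"
      proof (rule uniform_limitI)
        fix e :: real assume e: "e > 0"
        show "\<forall>\<^sub>F n in sequentially. \<forall>z\<in>UNIV. dist (indicator \<delta> z * s n z) (indicator \<delta> z * f z) < e"
          using uniform_limitD[OF s(2) e]
          by eventually_elim (use e in \<open>auto simp: indicator_def\<close>)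
      qed
    qed
    ultimately show ?thesis by simp
  qed
  obtain t where t: "\<And>n. simple (t n)" "uniform_limit UNIV t (\<lambda>z. indicator \<delta> z * f z) sequentially"
    using bborel_approx[OF f] by blast
  have "uniform_limit \<delta> t f sequentially"
    using uniform_limit_on_subset[OF t(2), of \<delta>]
    by (auto simp: uniform_limit_iff)
  then have ex: "?Q t (Phi (\<lambda>z. indicator \<delta> z * f z) x)" using t lim by blast
  show ?thesis
    unfolding spectral_integral_def
  proof (rule the_equality)
    show "\<exists>s. ?Q s (Phi (\<lambda>z. indicator \<delta> z * f z) x)" using ex by blast
    fix y assume "\<exists>s. ?Q s y"
    then show "y = Phi (\<lambda>z. indicator \<delta> z * f z) x" using lim LIMSEQ_unique by blast
  qed
qed

end

section \<open>Exponentials in the functional calculus\<close>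

text \<open>
  In this form the derivative transfers from integrands to operators: a bound of the remainder that is
  uniform in \<open>z\<close> becomes, through the supremum estimate of the calculus, a bound in operator norm.
\<close>

lemma has_vector_derivative_quadratic:
  fixes f :: "real \<Rightarrow> 'b::real_normed_vector"
  assumes "\<And>s. s \<in> S \<Longrightarrow> norm (f s - f t - (s - t) *\<^sub>R f') \<le> K * (s - t)\<^sup>2"
  shows "(f has_vector_derivative f') (at t within S)"
  unfolding has_vector_derivative_def has_derivative_within_alt
proof (intro conjI allI impI)
  show "bounded_linear (\<lambda>x. x *\<^sub>R f')" by (rule bounded_linear_scaleR_left)
  fix e :: real assume e: "e > 0"
  define d where "d = e / (\<bar>K\<bar> + 1)"
  have "d > 0" using e by (simp add: d_def)
  moreover have "norm (f s - f t - (s - t) *\<^sub>R f') \<le> e * norm (s - t)"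
    if s: "s \<in> S" "norm (s - t) < d" for s
  proof -
    have "norm (f s - f t - (s - t) *\<^sub>R f') \<le> K * (s - t)\<^sup>2" using assms s by blast
    also have "\<dots> \<le> (\<bar>K\<bar> + 1) * (s - t)\<^sup>2" by (intro mult_right_mono) auto
    also have "\<dots> = ((\<bar>K\<bar> + 1) * \<bar>s - t\<bar>) * \<bar>s - t\<bar>" by (simp add: power2_eq_square)
    also have "\<dots> \<le> ((\<bar>K\<bar> + 1) * d) * \<bar>s - t\<bar>"
      using s(2) by (intro mult_right_mono mult_left_mono) auto
    also have "(\<bar>K\<bar> + 1) * d = e" by (simp add: d_def)
    finally show ?thesis by simp
  qed
  ultimately show "\<exists>d>0. \<forall>y\<in>S. norm (y - t) < d \<longrightarrow>
      norm (f y - f t - (y - t) *\<^sub>R f') \<le> e * norm (y - t)" by blast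
qed

lemma pow_exp_Taylor:
  assumes C: "\<And>r. r \<in> {lo..hi} \<Longrightarrow> cmod (z ^ (m + 2) * exp (of_real r * z)) \<le> C"
    and s: "s \<in> {lo..hi}" and t: "t \<in> {lo..hi}"
  shows "cmod (z ^ m * exp (of_real s * z) - z ^ m * exp (of_real t * z)
    - of_real (s - t) * (z ^ (m + 1) * exp (of_real t * z))) \<le> C * (s - t)\<^sup>2"
proof -
  define f where "f i w = z ^ (m + i) * exp (w * z)" for i and w :: complex
  have "convex ((\<lambda>x. complex_of_real x) ` {lo..hi})"
    by (intro convex_linear_image convex_real_interval bounded_linear.linear bounded_linear_of_real)
  then have "cmod (f 0 (of_real s) - (\<Sum>i\<le>1. f i (of_real t) * (of_real s - of_real t) ^ i / fact i))
      \<le> C * cmod (of_real s - of_real t) ^ Suc 1 / fact 1"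
  proof (rule complex_Taylor)
    fix i x
    show "(f i has_field_derivative f (Suc i) x) (at x within (\<lambda>x. complex_of_real x) ` {lo..hi})"
      unfolding f_def by (auto intro!: derivative_eq_intros)
  qed (use C s t in \<open>auto simp: f_def\<close>)
  moreover have "cmod (of_real s - of_real t) ^ Suc 1 = (s - t)\<^sup>2"
    by (simp flip: of_real_diff add: power2_eq_square)
  ultimately show ?thesis
    by (simp add: f_def algebra_simps)
qed

text \<open>
  The symbol of the \<open>m\<close>-th time derivative of \<open>exp (t A)\<close>, restricted to the part \<open>W\<close> of the plane.
  Differentiation in \<open>t\<close> raises \<open>m\<close> by one and multiplication adds \<open>m\<close> and \<open>t\<close>, so this one family
  is closed under both operations.
\<close>

definition pexp :: "complex set \<Rightarrow> nat \<Rightarrow> real \<Rightarrow> complex \<Rightarrow> complex"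
  where "pexp W m t z = indicator W z * (z ^ m * exp (of_real t * z))"

lemma pexp_mult: "pexp V m s z * pexp W n t z = pexp (V \<inter> W) (m + n) (s + t) z"
  by (auto simp: pexp_def indicator_def power_add algebra_simps exp_add)

lemma pexp_indicator: "indicator V z * pexp W m t z = pexp (V \<inter> W) m t z"
  by (auto simp: pexp_def indicator_def)

lemma pexp_0_0: "pexp W 0 0 = indicator W"
  by (auto simp: pexp_def)

context spectral
begin

lemma bborel_pexp:
  assumes "W \<in> sets borel" "\<And>z. z \<in> W \<Longrightarrow> cmod (z ^ m * exp (of_real t * z)) \<le> C"
  shows "bborel (pexp W m t)"
proof (rule bborelI)
  show "pexp W m t \<in> borel_measurable borel"
    using assms(1) unfolding pexp_def[abs_def] by measurable
  show "cmod (pexp W m t z) \<le> \<bar>C\<bar>" for z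
    using assms(2)[of z] by (auto simp: pexp_def indicator_def)
qed

lemma pexp_bounded_set:
  assumes "bounded W"
  obtains C where "\<And>z t. z \<in> W \<Longrightarrow> t \<in> {lo..hi} \<Longrightarrow> cmod (z ^ m * exp (of_real t * z)) \<le> C"
proof -
  obtain R where R: "\<And>z. z \<in> W \<Longrightarrow> cmod z \<le> R" using assms by (auto simp: bounded_iff)
  have "cmod (z ^ m * exp (of_real t * z)) \<le> R ^ m * exp (max \<bar>lo\<bar> \<bar>hi\<bar> * R)"
    if z: "z \<in> W" and t: "t \<in> {lo..hi}" for z t
  proof -
    have "t * Re z \<le> \<bar>t * Re z\<bar>" by (rule abs_ge_self)
    also have "\<dots> \<le> \<bar>t\<bar> * cmod z"
      unfolding abs_mult by (intro mult_left_mono abs_Re_le_cmod) simp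
    also have "\<dots> \<le> max \<bar>lo\<bar> \<bar>hi\<bar> * R" using R[OF z] t by (intro mult_mono) auto
    finally have "cmod (exp (of_real t * z)) \<le> exp (max \<bar>lo\<bar> \<bar>hi\<bar> * R)" by simp
    moreover have "cmod (z ^ m) \<le> R ^ m" unfolding norm_power using R[OF z] by (intro power_mono) auto
    ultimately show ?thesis
      unfolding norm_mult using order_trans[OF norm_ge_zero R[OF z]] by (intro mult_mono) auto
  qed
  then show ?thesis using that by blast
qed

lemma bborel_pexp_bounded:
  assumes "W \<in> sets borel" "bounded W"
  shows "bborel (pexp W m t)"
proof -
  obtain C where "\<And>z r. z \<in> W \<Longrightarrow> r \<in> {t..t} \<Longrightarrow> cmod (z ^ m * exp (of_real r * z)) \<le> C"
    using pexp_bounded_set[OF assms(2), of t t m] by blast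
  then show ?thesis by (intro bborel_pexp[OF assms(1)]) auto
qed

lemma Phi_pexp_Taylor:
  assumes W: "W \<in> sets borel"
    and C: "\<And>i z r. i \<in> {m, m + 1, m + 2} \<Longrightarrow> z \<in> W \<Longrightarrow> r \<in> {lo..hi} \<Longrightarrow>
      cmod (z ^ i * exp (of_real r * z)) \<le> C"
    and s: "s \<in> {lo..hi}" and t: "t \<in> {lo..hi}"
  shows "norm (Phi (pexp W m s) - Phi (pexp W m t) - (s - t) *\<^sub>R Phi (pexp W (m + 1) t))
    \<le> 4 * E_bound * \<bar>C\<bar> * (s - t)\<^sup>2"
proof -
  have bborel: "bborel (pexp W m s)" "bborel (pexp W m t)" "bborel (pexp W (m + 1) t)"
    using C s t by (intro bborel_pexp[OF W]; blast)+
  have bc: "bborel (\<lambda>z. of_real (s - t) * pexp W (m + 1) t z)" by (intro bborel_mult bborel_const bborel)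
  let ?f = "\<lambda>z. pexp W m s z - pexp W m t z - of_real (s - t) * pexp W (m + 1) t z"
  have "Phi (pexp W m s) - Phi (pexp W m t) - (s - t) *\<^sub>R Phi (pexp W (m + 1) t) = Phi ?f"
    by (simp only: Phi_diff bborel bc Phi_scaleR)
  also have "norm \<dots> \<le> 4 * E_bound * (\<bar>C\<bar> * (s - t)\<^sup>2)"
  proof (rule Phi_norm)
    show "bborel ?f" by (intro Phi_diff bborel bc)
    fix z
    show "cmod (?f z) \<le> \<bar>C\<bar> * (s - t)\<^sup>2"
    proof (cases "z \<in> W")
      case True
      then have "cmod (z ^ (m + 2) * exp (of_real r * z)) \<le> C" if "r \<in> {lo..hi}" for r
        using C that by blast
      from pow_exp_Taylor[OF this s t] True
      have "cmod (?f z) \<le> C * (s - t)\<^sup>2" by (simp add: pexp_def)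
      also have "\<dots> \<le> \<bar>C\<bar> * (s - t)\<^sup>2" by (intro mult_right_mono) auto
      finally show ?thesis .
    qed (simp add: pexp_def)
  qed
  finally show ?thesis by (simp add: mult.assoc)
qed

lemma Phi_pexp_deriv:
  assumes W: "W \<in> sets borel"
    and C: "\<And>i z r. i \<in> {m, m + 1, m + 2} \<Longrightarrow> z \<in> W \<Longrightarrow> r \<in> {lo..hi} \<Longrightarrow>
      cmod (z ^ i * exp (of_real r * z)) \<le> C"
    and t: "t \<in> {lo..hi}"
  shows "((\<lambda>s. Phi (pexp W m s)) has_vector_derivative Phi (pexp W (m + 1) t)) (at t within {lo..hi})"
  by (rule has_vector_derivative_quadratic) (rule Phi_pexp_Taylor[OF W C _ t])

lemma pexp_bounded_set3:
  assumes "bounded W"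
  obtains C where "\<And>i z t. i \<in> {m, m + 1, m + 2} \<Longrightarrow> z \<in> W \<Longrightarrow> t \<in> {lo..hi} \<Longrightarrow>
    cmod (z ^ i * exp (of_real t * z)) \<le> C"
proof -
  have "\<exists>C. \<forall>z t. z \<in> W \<longrightarrow> t \<in> {lo..hi} \<longrightarrow> cmod (z ^ i * exp (of_real t * z)) \<le> C" for i
    using pexp_bounded_set[OF assms, of lo hi i] by metis
  then obtain C where C: "\<And>i z t. z \<in> W \<Longrightarrow> t \<in> {lo..hi} \<Longrightarrow> cmod (z ^ i * exp (of_real t * z)) \<le> C i"
    by metis
  show ?thesis
  proof (rule that[of "max (C m) (max (C (m + 1)) (C (m + 2)))"])
    fix i z t assume i: "i \<in> {m, m + 1, m + 2}" and "z \<in> W" "t \<in> {lo..hi}"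
    then have "cmod (z ^ i * exp (of_real t * z)) \<le> C i" using C by blast
    also have "C i \<le> max (C m) (max (C (m + 1)) (C (m + 2)))" using i by auto
    finally show "cmod (z ^ i * exp (of_real t * z)) \<le> max (C m) (max (C (m + 1)) (C (m + 2)))" .
  qed
qed

end


section \<open>Scalar type spectral operators and their weak solutions\<close>

locale scalar_type = spectral E for E :: "complex set \<Rightarrow> 'a::complex_banach \<Rightarrow> 'a" +
  fixes D :: "'a set" and A :: "'a \<Rightarrow> 'a"
  assumes dense: "closure D = UNIV"
    and support: "spectral_support E = spectrum D A"
    and domain: "D = {x. convergent
      (\<lambda>n. spectral_integral E {z \<in> spectrum D A. cmod z \<le> real n} (\<lambda>z. z) x)}"
    and op: "x \<in> D \<Longrightarrow>
      (\<lambda>n. spectral_integral E {z \<in> spectrum D A. cmod z \<le> real n} (\<lambda>z. z) x) \<longlonglongrightarrow> A x"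
begin

definition spectrum_cut :: "nat \<Rightarrow> complex set"
  where "spectrum_cut n = S \<inter> cball 0 (real n)"

lemma spectrum_cut_borel: "spectrum_cut n \<in> sets borel" and spectrum_cut_bounded: "bounded (spectrum_cut n)"
  unfolding spectrum_cut_def by (auto intro: bounded_subset[of "cball 0 (real n)"])

lemma integral_cut:
  "spectral_integral E {z \<in> spectrum D A. cmod z \<le> real n} (\<lambda>z. z) x = Phi (pexp (spectrum_cut n) 1 0) x"
proof -
  have "{z \<in> spectrum D A. cmod z \<le> real n} = spectrum_cut n"
    by (auto simp: spectrum_cut_def support[symmetric])
  moreover have "pexp (spectrum_cut n) 1 0 = (\<lambda>z. indicator (spectrum_cut n) z * z)"
    by (auto simp: pexp_def)
  ultimately show ?thesis
    using spectral_integral_eq[OF spectrum_cut_borel, of n "\<lambda>z. z" x] bborel_pexp_bounded[OF spectrum_cut_borel spectrum_cut_bounded, of n 1 0]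
    by simp
qed

lemma Phi_pexp_support:
  "bborel (pexp W m t) \<Longrightarrow> Phi (pexp (S \<inter> W) m t) x = Phi (pexp W m t) x"
  using Phi_support[of "pexp W m t" x] by (simp add: pexp_indicator)

lemma E_Phi_pexp: "\<delta> \<in> sets borel \<Longrightarrow> bborel (pexp W m t) \<Longrightarrow> E \<delta> (Phi (pexp W m t) x) = Phi (pexp (\<delta> \<inter> W) m t) x"
  using Phi_mult[OF bborel_indicator, of \<delta> "pexp W m t" x] by (simp add: Phi_indicator pexp_indicator)

lemma Phi_pexp_E: "\<delta> \<in> sets borel \<Longrightarrow> bborel (pexp W m t) \<Longrightarrow> Phi (pexp W m t) (E \<delta> x) = Phi (pexp (\<delta> \<inter> W) m t) x"
  using Phi_mult[OF _ bborel_indicator, of "pexp W m t" \<delta> x]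
  by (simp add: Phi_indicator pexp_indicator mult.commute[of "pexp _ _ _ _"])

lemma spectrum_cut_eventually:
  assumes "bounded \<delta>"
  shows "\<forall>\<^sub>F n in sequentially. \<delta> \<inter> spectrum_cut n = S \<inter> \<delta>"
proof -
  obtain R where R: "\<And>z. z \<in> \<delta> \<Longrightarrow> cmod z \<le> R" using assms by (auto simp: bounded_iff)
  obtain N where "R \<le> real N" using real_arch_simple by blast
  then have "\<delta> \<inter> spectrum_cut n = S \<inter> \<delta>" if "n \<ge> N" for n
    using R that by (fastforce simp: spectrum_cut_def)
  then show ?thesis by (auto simp: eventually_sequentially)
qed

text \<open>
  The integrals defining the operator are eventually constant on the range of \<open>E \<delta>\<close>, because the
  discs of integration finally contain the bounded set \<open>\<delta>\<close>.
\<close>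

lemma E_in_domain:
  assumes \<delta>: "\<delta> \<in> sets borel" "bounded \<delta>"
  shows "E \<delta> x \<in> D" "A (E \<delta> x) = Phi (pexp \<delta> 1 0) x"
proof -
  have "\<forall>\<^sub>F n in sequentially. Phi (pexp (spectrum_cut n) 1 0) (E \<delta> x) = Phi (pexp \<delta> 1 0) x"
    using spectrum_cut_eventually[OF \<delta>(2)]
    by eventually_elim
      (simp add: Phi_pexp_E \<delta> bborel_pexp_bounded spectrum_cut_borel spectrum_cut_bounded Phi_pexp_support)
  then have lim: "(\<lambda>n. Phi (pexp (spectrum_cut n) 1 0) (E \<delta> x)) \<longlonglongrightarrow> Phi (pexp \<delta> 1 0) x"
    by (rule tendsto_eventually)
  then show D: "E \<delta> x \<in> D" by (subst domain) (auto simp: integral_cut convergent_def)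
  show "A (E \<delta> x) = Phi (pexp \<delta> 1 0) x"
    using LIMSEQ_unique[OF op[OF D]] lim by (simp add: integral_cut)
qed

lemma E_A:
  assumes \<delta>: "\<delta> \<in> sets borel" "bounded \<delta>" and x: "x \<in> D"
  shows "E \<delta> (A x) = Phi (pexp \<delta> 1 0) x"
proof -
  have "(\<lambda>n. E \<delta> (Phi (pexp (spectrum_cut n) 1 0) x)) \<longlonglongrightarrow> E \<delta> (A x)"
    using bounded_linear.tendsto[OF linear[OF \<delta>(1)] op[OF x]] by (simp add: integral_cut)
  moreover have "\<forall>\<^sub>F n in sequentially. E \<delta> (Phi (pexp (spectrum_cut n) 1 0) x) = Phi (pexp \<delta> 1 0) x"
    using spectrum_cut_eventually[OF \<delta>(2)]
    by eventually_elim
      (simp add: E_Phi_pexp \<delta> bborel_pexp_bounded spectrum_cut_borel spectrum_cut_bounded Phi_pexp_support)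
  then have "(\<lambda>n. E \<delta> (Phi (pexp (spectrum_cut n) 1 0) x)) \<longlonglongrightarrow> Phi (pexp \<delta> 1 0) x"
    by (rule tendsto_eventually)
  ultimately show ?thesis using LIMSEQ_unique by blast
qed

lemma adjoint_unique:
  assumes h: "bounded_clinear h" "\<And>x. x \<in> D \<Longrightarrow> g (A x) = h x"
  shows "adjoint_op D A g = h"
  unfolding adjoint_op_def
proof (rule the_equality)
  fix k assume k: "bounded_clinear k \<and> (\<forall>x\<in>D. g (A x) = k x)"
  have "closed {x. k x = h x}"
    using k h bounded_clinear_imp_linear
    by (intro closed_Collect_eq linear_continuous_on) auto
  moreover have "D \<subseteq> {x. k x = h x}" using k h by auto
  ultimately have "closure D \<subseteq> {x. k x = h x}" by (rule closure_minimal[rotated])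
  then show "k = h" using dense by auto
qed (use h in auto)

lemma adjoint_E:
  assumes g: "bounded_clinear g" and \<delta>: "\<delta> \<in> sets borel" "bounded \<delta>"
  shows "(\<lambda>x. g (E \<delta> x)) \<in> adjoint_domain D A"
    "adjoint_op D A (\<lambda>x. g (E \<delta> x)) = (\<lambda>x. g (Phi (pexp \<delta> 1 0) x))"
proof -
  have h: "bounded_clinear (\<lambda>x. g (Phi (pexp \<delta> 1 0) x))"
    by (intro bounded_clinear_compose[OF g] Phi_clinear bborel_pexp_bounded \<delta>)
  have gA: "g (E \<delta> (A x)) = g (Phi (pexp \<delta> 1 0) x)" if "x \<in> D" for x
    using E_A[OF \<delta> that] by simp
  show "(\<lambda>x. g (E \<delta> x)) \<in> adjoint_domain D A"
    unfolding adjoint_domain_def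
    using bounded_clinear_compose[OF g clinear[OF \<delta>(1)]] h gA by blast
  show "adjoint_op D A (\<lambda>x. g (E \<delta> x)) = (\<lambda>x. g (Phi (pexp \<delta> 1 0) x))"
    by (rule adjoint_unique[OF h gA])
qed

text \<open>
  On the range of \<open>E \<delta>\<close> with \<open>\<delta>\<close> bounded the operator is bounded, and the weak equation is
  integrated there: the functionals \<open>g \<circ> E \<delta>\<close> all lie in the domain of the adjoint, and they
  separate the points of the range.
\<close>

lemma weak_solution_strong_deriv:
  assumes y: "weak_solution D A y" and \<delta>: "\<delta> \<in> sets borel" "bounded \<delta>" and t: "t \<ge> 0"
  shows "((\<lambda>s. E \<delta> (y s)) has_vector_derivative Phi (pexp \<delta> 1 0) (y t)) (at t within {0..})"
proof -
  let ?B = "\<lambda>s. Phi (pexp \<delta> 1 0) (y s)"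
  have cont: "continuous_on {0..} y" using y by (simp add: weak_solution_def)
  have contB: "continuous_on {0..b} ?B" for b
    by (intro continuous_intros continuous_on_subset[OF cont]) auto
  have eq: "E \<delta> (y b) = E \<delta> (y 0) + integral {0..b} ?B" if b: "b \<ge> 0" for b
  proof (rule ccontr)
    let ?w = "E \<delta> (y b) - E \<delta> (y 0) - integral {0..b} ?B"
    assume "\<not> ?thesis"
    then have "?w \<noteq> 0" by (simp add: algebra_simps)
    then obtain g :: "'a \<Rightarrow> complex" where g: "bounded_clinear g" "g ?w \<noteq> 0"
      by (rule ex_functional_nonzero)
    interpret g: bounded_linear g by (rule bounded_clinear_imp_linear[OF g(1)])
    have "((\<lambda>s. g (E \<delta> (y s))) has_vector_derivative g (?B s)) (at s within {0..b})"
      if "s \<in> {0..b}" for s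
    proof -
      have "((\<lambda>s. g (E \<delta> (y s))) has_vector_derivative g (?B s)) (at s within {0..})"
        using y adjoint_E[OF g(1) \<delta>] that unfolding weak_solution_def by fastforce
      then show ?thesis by (rule has_vector_derivative_within_subset) auto
    qed
    then have "((\<lambda>s. g (?B s)) has_integral g (E \<delta> (y b)) - g (E \<delta> (y 0))) {0..b}"
      using b by (intro fundamental_theorem_of_calculus) auto
    moreover have "((\<lambda>s. g (?B s)) has_integral g (integral {0..b} ?B)) {0..b}"
      using has_integral_linear[OF integrable_integral[OF integrable_continuous_interval[OF contB]] g.bounded_linear_axioms]
      by (simp add: o_def)
    ultimately have "g (E \<delta> (y b)) - g (E \<delta> (y 0)) = g (integral {0..b} ?B)"
      by (rule has_integral_unique)
    then show False using g(2) by (simp add: g.diff)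
  qed
  have d: "((\<lambda>s. E \<delta> (y 0) + integral {0..s} ?B) has_vector_derivative 0 + ?B t) (at t within {0..t + 1})"
    using t
    by (intro has_vector_derivative_add has_vector_derivative_const
        integral_has_vector_derivative contB) auto
  have "((\<lambda>s. E \<delta> (y s)) has_vector_derivative 0 + ?B t) (at t within {0..t + 1})"
  proof (rule has_vector_derivative_transform[OF _ _ d])
    show "t \<in> {0..t + 1}" using t by simp
    show "E \<delta> (y s) = E \<delta> (y 0) + integral {0..s} ?B" if "s \<in> {0..t + 1}" for s
      using that by (intro eq) simp
  qed
  moreover have "at t within {0..t + 1} = at t within {0..}"
    by (rule at_within_nhd[of _ "{..<t + 1}"]) auto
  ultimately show ?thesis by simp
qed

lemma weak_solution_block:
  assumes y: "weak_solution D A y" and \<delta>: "\<delta> \<in> sets borel" "bounded \<delta>"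
    and t: "t \<ge> 0" and T: "T \<ge> 0"
  shows "E \<delta> (y t) = Phi (pexp \<delta> 0 (t - T)) (y T)"
proof -
  \<comment> \<open>The usual uniqueness argument: transporting \<open>y s\<close> to time \<open>t\<close> gives a constant function of \<open>s\<close>.\<close>
  define w where "w s = Phi (pexp \<delta> 0 (t - s)) (E \<delta> (y s))" for s
  let ?I = "{min t T..max t T}"
  obtain C where C: "\<And>i z r. i \<in> {0, 0 + 1, 0 + 2} \<Longrightarrow> z \<in> \<delta> \<Longrightarrow> r \<in> {t - max t T..t - min t T} \<Longrightarrow>
    cmod (z ^ i * exp (of_real r * z)) \<le> C"
    using pexp_bounded_set3[OF \<delta>(2)] by metis
  note bborel = bborel_pexp_bounded[OF \<delta>]
  have "(w has_vector_derivative 0) (at s within ?I)" if s: "s \<in> ?I" for s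
  proof -
    have "((\<lambda>s. Phi (pexp \<delta> 0 (t - s))) has_vector_derivative - Phi (pexp \<delta> 1 (t - s))) (at s within ?I)"
    proof (rule has_vector_derivative_quadratic)
      fix r assume r: "r \<in> ?I"
      have "norm (Phi (pexp \<delta> 0 (t - r)) - Phi (pexp \<delta> 0 (t - s)) -
          ((t - r) - (t - s)) *\<^sub>R Phi (pexp \<delta> (0 + 1) (t - s)))
          \<le> 4 * E_bound * \<bar>C\<bar> * ((t - r) - (t - s))\<^sup>2"
        by (rule Phi_pexp_Taylor[OF \<delta>(1) C]) (use r s in auto)
      then show "norm (Phi (pexp \<delta> 0 (t - r)) - Phi (pexp \<delta> 0 (t - s)) - (r - s) *\<^sub>R - Phi (pexp \<delta> 1 (t - s)))
          \<le> 4 * E_bound * \<bar>C\<bar> * (r - s)\<^sup>2"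
        by (simp add: power2_commute scaleR_diff_left)
    qed
    moreover have "((\<lambda>s. E \<delta> (y s)) has_vector_derivative Phi (pexp \<delta> 1 0) (y s)) (at s within ?I)"
      by (rule has_vector_derivative_within_subset[OF weak_solution_strong_deriv[OF y \<delta>]])
        (use s t T in auto)
    ultimately have "((\<lambda>s. Phi (pexp \<delta> 0 (t - s)) (E \<delta> (y s))) has_vector_derivative
        Phi (pexp \<delta> 0 (t - s)) (Phi (pexp \<delta> 1 0) (y s)) + (- Phi (pexp \<delta> 1 (t - s))) (E \<delta> (y s)))
        (at s within ?I)"
      by (rule bounded_bilinear.has_vector_derivative[OF bounded_bilinear_blinfun_apply])
    moreover have "Phi (pexp \<delta> 0 (t - s)) (Phi (pexp \<delta> 1 0) (y s)) = Phi (pexp \<delta> 1 (t - s)) (y s)"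
      by (simp add: Phi_mult bborel pexp_mult)
    moreover have "(- Phi (pexp \<delta> 1 (t - s))) (E \<delta> (y s)) = - Phi (pexp \<delta> 1 (t - s)) (y s)"
      by (simp add: blinfun.minus_left Phi_pexp_E \<delta> bborel)
    ultimately show ?thesis by (simp add: w_def[abs_def])
  qed
  then obtain c where "\<forall>s\<in>?I. w s = c"
    using has_derivative_zero_constant[of ?I w] by (auto simp: has_vector_derivative_def)
  then have "w t = w T" by simp
  moreover have "w t = E \<delta> (y t)" by (simp add: w_def pexp_0_0 Phi_indicator \<delta> E_E)
  moreover have "w T = Phi (pexp \<delta> 0 (t - T)) (y T)" by (simp add: w_def Phi_pexp_E \<delta> bborel)
  ultimately show ?thesis by simp
qed

text \<open>
  Going backwards in time from \<open>T\<close> needs the function \<open>exp ((t - T) z)\<close>, which is bounded on the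
  spectrum as soon as the real part is bounded below there.
\<close>

lemma weak_solution_backward:
  assumes y: "weak_solution D A y" and t: "t \<ge> 0" and T: "T \<ge> 0"
    and bborel: "bborel (pexp S 0 (t - T))"
  shows "y t = Phi (pexp S 0 (t - T)) (y T)"
proof -
  have "E \<delta> (y t - Phi (pexp S 0 (t - T)) (y T)) = 0" if \<delta>: "\<delta> \<in> sets borel" "bounded \<delta>" for \<delta>
  proof -
    have "E \<delta> (Phi (pexp S 0 (t - T)) (y T)) = Phi (pexp \<delta> 0 (t - T)) (y T)"
      using Phi_pexp_support[OF bborel_pexp_bounded[OF \<delta>]] E_Phi_pexp[OF \<delta>(1) bborel]
      by (simp add: Int_commute)
    then show ?thesis
      using weak_solution_block[OF y \<delta> t T] linear_diff[OF bounded_linear.linear[OF linear[OF \<delta>(1)]]]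
      by simp
  qed
  then have "y t - Phi (pexp S 0 (t - T)) (y T) = 0" by (rule zero_if_bounded_parts_zero)
  then show ?thesis by simp
qed

end

lemma scalar_type_spectralE:
  assumes "scalar_type_spectral D A"
  obtains E where "scalar_type E D A"
  using assms unfolding scalar_type_spectral_def scalar_type_def spectral_def scalar_type_axioms_def
    closed_densely_defined_def by blast

section \<open>Gevrey estimates on the spectrum\<close>

lemma power_div_fact_le_exp:
  fixes x :: real
  assumes "x \<ge> 0"
  shows "x ^ n / fact n \<le> exp x"
proof -
  have "(\<Sum>k\<in>{n}. x ^ k /\<^sub>R fact k) \<le> (\<Sum>k. x ^ k /\<^sub>R fact k)"
    by (rule sum_le_suminf[OF summable_exp_generic]) (use assms in auto)
  then show ?thesis by (simp add: exp_def field_simps)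
qed

lemma P_region_cmod_bound:
  assumes \<beta>: "\<beta> \<ge> 1" and b: "b > 0" and z: "z \<in> P_region \<beta> b"
  shows "cmod z \<le> 1 + b powr - \<beta> \<or>
    Re z \<ge> 1 \<and> cmod z \<le> (1 + b powr - \<beta>) * Re z powr \<beta>"
proof -
  have Im: "b * \<bar>Im z\<bar> powr (1 / \<beta>) \<le> Re z" using z by (simp add: P_region_def)
  moreover have "0 \<le> b * \<bar>Im z\<bar> powr (1 / \<beta>)" using b by simp
  ultimately have Re0: "Re z \<ge> 0" by linarith
  have "\<bar>Im z\<bar> powr (1 / \<beta>) \<le> Re z / b" using Im b by (simp add: field_simps)
  then have "(\<bar>Im z\<bar> powr (1 / \<beta>)) powr \<beta> \<le> (Re z / b) powr \<beta>"
    using \<beta> by (intro powr_mono2) auto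
  then have "\<bar>Im z\<bar> \<le> (Re z / b) powr \<beta>" using \<beta> by (simp add: powr_powr)
  also have "\<dots> = b powr - \<beta> * Re z powr \<beta>"
    using Re0 b by (simp add: powr_divide powr_minus_divide)
  finally have I: "\<bar>Im z\<bar> \<le> b powr - \<beta> * Re z powr \<beta>" .
  have cm: "cmod z \<le> Re z + \<bar>Im z\<bar>" using cmod_le[of z] Re0 by simp
  show ?thesis
  proof (cases "Re z \<ge> 1")
    case True
    then have "Re z powr 1 \<le> Re z powr \<beta>" using \<beta> by (intro powr_mono) auto
    then have "Re z \<le> Re z powr \<beta>" using True by simp
    then have "cmod z \<le> (1 + b powr - \<beta>) * Re z powr \<beta>" using cm I by (simp add: algebra_simps)
    then show ?thesis using True by blast
  next
    case False
    then have "Re z powr \<beta> \<le> 1 powr \<beta>" using Re0 \<beta> by (intro powr_mono2) auto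
    then have "b powr - \<beta> * Re z powr \<beta> \<le> b powr - \<beta> * 1" by (intro mult_left_mono) auto
    then have "cmod z \<le> 1 + b powr - \<beta>" using cm I False by linarith
    then show ?thesis by blast
  qed
qed

text \<open>
  Raising \<open>x ^ n / n! \<le> exp x\<close> to the power \<open>\<beta>\<close> turns exponential decay in the real part into
  factorial bounds of order \<open>\<beta>\<close>; the constant tends to \<open>0\<close> as \<open>s\<close> grows.
\<close>

lemma pow_exp_decay_bound:
  assumes \<beta>: "\<beta> \<ge> 1" and s: "s > 0" and x: "Re z \<ge> 1" and z: "cmod z \<le> C * Re z powr \<beta>"
  shows "cmod (z ^ n * exp (of_real (- s) * z)) \<le> (C * (\<beta> / s) powr \<beta>) ^ n * fact n powr \<beta>"
proof -
  let ?x = "Re z"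
  have C: "C \<ge> 0" using order_trans[OF norm_ge_zero z] x by (simp add: zero_le_mult_iff)
  have "(s * ?x / \<beta>) ^ n / fact n \<le> exp (s * ?x / \<beta>)"
    using s x \<beta> by (intro power_div_fact_le_exp) auto
  then have "?x ^ n \<le> fact n * (\<beta> / s) ^ n * exp (s * ?x / \<beta>)"
    using s \<beta> by (simp add: power_divide power_mult_distrib field_simps)
  then have "(?x ^ n) powr \<beta> \<le> (fact n * (\<beta> / s) ^ n * exp (s * ?x / \<beta>)) powr \<beta>"
    using \<beta> x by (intro powr_mono2) auto
  also have "\<dots> = fact n powr \<beta> * ((\<beta> / s) ^ n) powr \<beta> * exp (s * ?x)"
    using \<beta> s by (simp add: powr_mult exp_powr_real)
  also have "((\<beta> / s) ^ n) powr \<beta> = ((\<beta> / s) powr \<beta>) ^ n"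
    using \<beta> s by (simp add: powr_powr powr_realpow[symmetric] mult.commute)
  finally have 1: "(?x powr \<beta>) ^ n \<le> fact n powr \<beta> * ((\<beta> / s) powr \<beta>) ^ n * exp (s * ?x)"
    using x by (simp add: powr_powr powr_realpow[symmetric] mult.commute)
  have "cmod (z ^ n * exp (of_real (- s) * z)) = cmod z ^ n * exp (- (s * ?x))"
    by (simp add: norm_mult norm_power)
  also have "\<dots> \<le> (C * ?x powr \<beta>) ^ n * exp (- (s * ?x))"
    using z by (intro mult_right_mono power_mono) auto
  also have "\<dots> = C ^ n * exp (- (s * ?x)) * (?x powr \<beta>) ^ n"
    by (simp add: power_mult_distrib)
  also have "\<dots> \<le> C ^ n * exp (- (s * ?x)) * (fact n powr \<beta> * ((\<beta> / s) powr \<beta>) ^ n * exp (s * ?x))"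
    using 1 C by (intro mult_left_mono) auto
  also have "\<dots> = C ^ n * (fact n powr \<beta> * ((\<beta> / s) powr \<beta>) ^ n) * (exp (- (s * ?x)) * exp (s * ?x))"
    by (simp only: mult_ac)
  also have "exp (- (s * ?x)) * exp (s * ?x) = 1" by (simp flip: exp_add)
  finally show ?thesis by (simp add: power_mult_distrib mult_ac)
qed

lemma pow_exp_sector_bound:
  assumes \<beta>: "\<beta> \<ge> 1" and b: "b > 0" and bdd: "bounded (W - P_region \<beta> b)"
  obtains R C where "R > 0" "C > 0"
    "\<And>z n s s0 s1. z \<in> W \<Longrightarrow> 0 < s0 \<Longrightarrow> s \<in> {s0..s1} \<Longrightarrow>
      cmod (z ^ n * exp (of_real (- s) * z)) \<le>
        R ^ n * exp (s1 * R) + (C * (\<beta> / s0) powr \<beta>) ^ n * fact n powr \<beta>"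
proof -
  define C where "C = 1 + b powr - \<beta>"
  obtain R0 where R0: "\<And>z. z \<in> W - P_region \<beta> b \<Longrightarrow> cmod z \<le> R0"
    using bdd unfolding bounded_iff by blast
  define R where "R = max R0 C"
  have C: "C > 0" using powr_ge_zero[of b "- \<beta>"] unfolding C_def by linarith
  have R: "R > 0" using C by (simp add: R_def)
  have "cmod (z ^ n * exp (of_real (- s) * z)) \<le>
      R ^ n * exp (s1 * R) + (C * (\<beta> / s0) powr \<beta>) ^ n * fact n powr \<beta>"
    if z: "z \<in> W" and s: "0 < s0" "s \<in> {s0..s1}" for z n s s0 s1
  proof -
    have "cmod z \<le> R \<or> Re z \<ge> 1 \<and> cmod z \<le> C * Re z powr \<beta>"
      using R0[of z] P_region_cmod_bound[OF \<beta> b, of z] z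
      by (cases "z \<in> P_region \<beta> b") (auto simp: R_def C_def)
    then show ?thesis
    proof
      assume zR: "cmod z \<le> R"
      have "- (s * Re z) \<le> s1 * R"
      proof -
        have "- (s * Re z) = s * (- Re z)" by simp
        also have "\<dots> \<le> s * R" using s abs_Re_le_cmod[of z] zR by (intro mult_left_mono) auto
        also have "\<dots> \<le> s1 * R" using s R by (intro mult_right_mono) auto
        finally show ?thesis .
      qed
      then have "cmod (z ^ n * exp (of_real (- s) * z)) \<le> R ^ n * exp (s1 * R)"
        using zR R by (simp add: norm_mult norm_power mult_mono power_mono)
      moreover have "0 \<le> (C * (\<beta> / s0) powr \<beta>) ^ n * fact n powr \<beta>" using C by simp
      ultimately show ?thesis by linarith
    next
      assume zC: "Re z \<ge> 1 \<and> cmod z \<le> C * Re z powr \<beta>"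
      have "cmod (z ^ n * exp (of_real (- s) * z)) \<le> (C * (\<beta> / s) powr \<beta>) ^ n * fact n powr \<beta>"
        using s zC by (intro pow_exp_decay_bound[OF \<beta>]) auto
      also have "\<dots> \<le> (C * (\<beta> / s0) powr \<beta>) ^ n * fact n powr \<beta>"
        using s \<beta> C
        by (intro mult_right_mono power_mono mult_left_mono powr_mono2 divide_left_mono) auto
      also have "\<dots> \<le> R ^ n * exp (s1 * R) + (C * (\<beta> / s0) powr \<beta>) ^ n * fact n powr \<beta>"
        using R by simp
      finally show ?thesis .
    qed
  qed
  with R C show ?thesis by (rule that)
qed


section \<open>Sufficiency of the spectral condition\<close>

lemma at_within_atLeast_neq_bot:
  assumes "0 \<le> t"
  shows "at t within {0::real..} \<noteq> bot"
proof -
  have "{t<..} \<subseteq> {0..}" using assms by auto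
  then have "at_right t \<le> at t within {0..}" by (rule at_le)
  then show ?thesis using trivial_limit_at_right_real[of t] by (auto simp: bot_unique)
qed

context scalar_type
begin

text \<open>
  Each derivative within the half line is computed from the representation of the solution by
  its value at an arbitrary later time \<open>T\<close>. The decay of the symbol is available only at positive
  distance from \<open>T\<close>, so differentiation takes place up to the midpoint between \<open>t\<close> and \<open>T\<close>.
\<close>

lemma weak_solution_nth_deriv:
  assumes y: "weak_solution D A y"
    and bd: "\<And>n s0 s1. 0 < s0 \<Longrightarrow>
      \<exists>C. \<forall>z\<in>S. \<forall>s\<in>{s0..s1}. cmod (z ^ n * exp (of_real (- s) * z)) \<le> C"
    and t: "0 \<le> t" "t < T"
  shows "nth_deriv {0..} n y t = Phi (pexp S n (t - T)) (y T) \<and>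
    (nth_deriv {0..} n y has_vector_derivative nth_deriv {0..} (Suc n) y t) (at t within {0..})"
proof -
  have bborel: "bborel (pexp S m (t - T))" if "t < T" for m t T
  proof -
    obtain C where C: "\<forall>z\<in>S. \<forall>s\<in>{T - t..T - t}. cmod (z ^ m * exp (of_real (- s) * z)) \<le> C"
      using bd[of "T - t" "T - t" m] \<open>t < T\<close> by auto
    have "cmod (z ^ m * exp (of_real (t - T) * z)) \<le> C" if "z \<in> S" for z
      using C[rule_format, OF that, of "T - t"] by simp
    then show ?thesis by (rule bborel_pexp[OF support_borel])
  qed
  have deriv: "((\<lambda>s. Phi (pexp S m (s - T)) (y T)) has_vector_derivative
      Phi (pexp S (Suc m) (t - T)) (y T)) (at t within {0..(t + T) / 2})"
    if t: "0 \<le> t" "t < T" for m t T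
  proof -
    let ?T' = "(t + T) / 2"
    have "\<exists>C. \<forall>z\<in>S. \<forall>s\<in>{T - ?T'..T}. cmod (z ^ i * exp (of_real (- s) * z)) \<le> C" for i
      using bd[of "T - ?T'" T i] t by (simp add: field_simps)
    then obtain C where C: "\<And>i z s. z \<in> S \<Longrightarrow> s \<in> {T - ?T'..T} \<Longrightarrow>
        cmod (z ^ i * exp (of_real (- s) * z)) \<le> C i"
      by metis
    define K where "K = max (C m) (max (C (m + 1)) (C (m + 2)))"
    have K: "cmod (z ^ i * exp (of_real r * z)) \<le> K"
      if i: "i \<in> {m, m + 1, m + 2}" and z: "z \<in> S" and r: "r \<in> {- T..?T' - T}" for i z r
    proof -
      have "cmod (z ^ i * exp (of_real (- (- r)) * z)) \<le> C i" by (rule C[OF z]) (use r in \<open>auto simp: field_simps\<close>)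
      also have "C i \<le> K" using i by (auto simp: K_def)
      finally show ?thesis by simp
    qed
    have "((\<lambda>s. Phi (pexp S m (s - T))) has_vector_derivative Phi (pexp S (Suc m) (t - T)))
        (at t within {0..?T'})"
    proof (rule has_vector_derivative_quadratic)
      fix s assume s: "s \<in> {0..?T'}"
      have "norm (Phi (pexp S m (s - T)) - Phi (pexp S m (t - T)) -
          ((s - T) - (t - T)) *\<^sub>R Phi (pexp S (m + 1) (t - T)))
          \<le> 4 * E_bound * \<bar>K\<bar> * ((s - T) - (t - T))\<^sup>2"
        by (rule Phi_pexp_Taylor[where lo = "- T" and hi = "?T' - T", OF support_borel K])
          (use s t in auto)
      then show "norm (Phi (pexp S m (s - T)) - Phi (pexp S m (t - T)) -
          (s - t) *\<^sub>R Phi (pexp S (Suc m) (t - T))) \<le> 4 * E_bound * \<bar>K\<bar> * (s - t)\<^sup>2"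
        by simp
    qed
    then show ?thesis
      by (rule bounded_linear.has_vector_derivative[OF blinfun.bounded_linear_left])
  qed
  have step: "(f has_vector_derivative Phi (pexp S (Suc m) (t - T)) (y T)) (at t within {0..})"
    if f: "\<And>t. 0 \<le> t \<Longrightarrow> t < T \<Longrightarrow> f t = Phi (pexp S m (t - T)) (y T)"
      and t: "0 \<le> t" "t < T" for f m t T
  proof -
    have "(f has_vector_derivative Phi (pexp S (Suc m) (t - T)) (y T)) (at t within {0..(t + T) / 2})"
      by (rule has_vector_derivative_transform[OF _ _ deriv]) (use f t in auto)
    moreover have "at t within {0..(t + T) / 2} = at t within {0..}"
      by (rule at_within_nhd[of _ "{..<(t + T) / 2}"]) (use t in auto)
    ultimately show ?thesis by simp
  qed
  have rep: "nth_deriv {0..} n y t = Phi (pexp S n (t - T)) (y T)"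
    if "0 \<le> t" "t < T" for n t T
    using that
  proof (induction n arbitrary: t)
    case 0
    then show ?case using weak_solution_backward[OF y _ _ bborel] by simp
  next
    case (Suc n)
    show ?case
      using vector_derivative_within[OF at_within_atLeast_neq_bot step[OF Suc.IH]] Suc.prems
      by simp
  qed
  show ?thesis
    using rep[OF t, of n] step[OF rep t, of n] rep[OF t, of "Suc n"] by simp
qed

lemma sector_imp_beurling:
  assumes y: "weak_solution D A y" and \<beta>: "\<beta> \<ge> 1" and b: "b > 0"
    and bdd: "bounded (S - P_region \<beta> b)"
  shows "y \<in> gevrey_beurling \<beta> {0..}"
proof -
  obtain R C where R: "R > 0" and C: "C > 0" and RC:
    "\<And>z n s s0 s1. z \<in> S \<Longrightarrow> 0 < s0 \<Longrightarrow> s \<in> {s0..s1} \<Longrightarrow>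
      cmod (z ^ n * exp (of_real (- s) * z)) \<le>
        R ^ n * exp (s1 * R) + (C * (\<beta> / s0) powr \<beta>) ^ n * fact n powr \<beta>"
    using pow_exp_sector_bound[OF \<beta> b bdd] by metis
  have bd: "\<exists>C. \<forall>z\<in>S. \<forall>s\<in>{s0..s1}. cmod (z ^ n * exp (of_real (- s) * z)) \<le> C"
    if "0 < s0" for n s0 s1
    using RC[OF _ that] by blast
  note nth = weak_solution_nth_deriv[OF y bd]
  have "y \<in> C_infinity {0..}"
    unfolding C_infinity_def differentiable_on_def
  proof (intro CollectI allI ballI)
    fix n and t :: real assume "t \<in> {0..}"
    then have "(nth_deriv {0..} n y has_vector_derivative nth_deriv {0..} (Suc n) y t) (at t within {0..})"
      using nth[of t "t + 1" n] by simp
    then show "nth_deriv {0..} n y differentiable (at t within {0..})"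
      by (rule differentiableI_vector)
  qed
  moreover have "\<exists>c>0. \<forall>n. \<forall>t\<in>{a..b}. norm (nth_deriv {0..} n y t) \<le> c * \<alpha> ^ n * fact n powr \<beta>"
    if ab: "{a..b} \<subseteq> {0..}" and \<alpha>: "\<alpha> > 0" for a b \<alpha>
  proof -
    \<comment> \<open>The distance to \<open>T\<close> is chosen so that the decay constant becomes exactly \<open>\<alpha>\<close>.\<close>
    define s0 where "s0 = \<beta> * (C / \<alpha>) powr (1 / \<beta>)"
    define T where "T = max b 0 + s0"
    define c where "c = 4 * E_bound * (exp (T * R) * exp (R / \<alpha>) + 1) * (norm (y T) + 1)"
    have s0: "s0 > 0" using \<beta> C \<alpha> by (simp add: s0_def)
    have "\<beta> / s0 = (\<alpha> / C) powr (1 / \<beta>)"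
      using \<beta> C \<alpha> by (simp add: s0_def powr_divide)
    then have q: "C * (\<beta> / s0) powr \<beta> = \<alpha>"
      using \<beta> C \<alpha> by (simp add: powr_powr)
    have "c > 0"
      unfolding c_def using E_bound(1) by (intro mult_pos_pos add_pos_pos add_nonneg_pos) auto
    moreover have "norm (nth_deriv {0..} n y t) \<le> c * \<alpha> ^ n * fact n powr \<beta>" if t: "t \<in> {a..b}" for n t
    proof -
      have t0: "0 \<le> t" "t < T" "T - t \<in> {s0..T}" using t ab s0 by (auto simp: T_def)
      let ?K = "exp (T * R) * exp (R / \<alpha>) + 1"
      have f1: "fact n \<le> (fact n :: real) powr \<beta>"
        using powr_mono[of 1 \<beta> "fact n :: real"] \<beta> by simp
      have "(R / \<alpha>) ^ n \<le> exp (R / \<alpha>) * fact n"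
        using power_div_fact_le_exp[of "R / \<alpha>" n] R \<alpha> by (simp add: field_simps)
      also have "\<dots> \<le> exp (R / \<alpha>) * fact n powr \<beta>" using f1 by simp
      finally have Rn: "R ^ n \<le> exp (R / \<alpha>) * fact n powr \<beta> * \<alpha> ^ n"
        using \<alpha> by (simp add: power_divide field_simps)
      have bnd: "cmod (z ^ n * exp (of_real (t - T) * z)) \<le> ?K * \<alpha> ^ n * fact n powr \<beta>"
        if z: "z \<in> S" for z
      proof -
        have "cmod (z ^ n * exp (of_real (- (T - t)) * z)) \<le>
            R ^ n * exp (T * R) + \<alpha> ^ n * fact n powr \<beta>"
          using RC[OF z s0 t0(3), of n] by (simp only: q)
        also have "\<dots> \<le> (exp (R / \<alpha>) * fact n powr \<beta> * \<alpha> ^ n) * exp (T * R) + \<alpha> ^ n * fact n powr \<beta>"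
          using Rn by simp
        also have "\<dots> = ?K * \<alpha> ^ n * fact n powr \<beta>" by (simp add: algebra_simps)
        finally show ?thesis by simp
      qed
      have "norm (Phi (pexp S n (t - T))) \<le> 4 * E_bound * (?K * \<alpha> ^ n * fact n powr \<beta>)"
      proof (rule Phi_norm[OF bborel_pexp[OF support_borel bnd]])
        show "cmod (pexp S n (t - T) z) \<le> ?K * \<alpha> ^ n * fact n powr \<beta>" for z
          using bnd[of z] \<alpha> by (auto simp: pexp_def indicator_def)
      qed
      moreover from this have "0 \<le> 4 * E_bound * (?K * \<alpha> ^ n * fact n powr \<beta>)"
        by (rule order_trans[OF norm_ge_zero])
      ultimately have "norm (Phi (pexp S n (t - T)) (y T)) \<le>
          4 * E_bound * (?K * \<alpha> ^ n * fact n powr \<beta>) * (norm (y T) + 1)"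
        by (intro order_trans[OF norm_blinfun] mult_mono) simp_all
      also have "\<dots> = c * \<alpha> ^ n * fact n powr \<beta>" by (simp add: c_def)
      finally show ?thesis using nth[OF _ t0(1,2), of n] by simp
    qed
    ultimately show ?thesis by blast
  qed
  ultimately show ?thesis unfolding gevrey_beurling_def by blast
qed

end

section \<open>Necessity of the spectral condition\<close>

text \<open>
  Summing the hypothesis over \<open>k\<close>, after taking roots of order \<open>\<beta>\<close>, replaces the optimization
  over \<open>k\<close>: a Gevrey bound of order \<open>\<beta>\<close> forces coefficients to decay like
  \<open>exp (- const \<rho> powr (1 / \<beta>))\<close>.
\<close>

lemma fact_powr_bound_imp_exp_bound:
  fixes \<gamma> \<rho> K \<beta> :: real
  assumes pos: "\<gamma> > 0" "\<rho> > 0" "K > 0" "\<beta> \<ge> 1"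
    and le: "\<And>k. \<gamma> * \<rho> ^ k \<le> K * fact k powr \<beta>"
  shows "\<gamma> powr (1 / \<beta>) * exp (\<rho> powr (1 / \<beta>) / 2) \<le> 2 * K powr (1 / \<beta>)"
proof -
  define \<tau> where "\<tau> = \<rho> powr (1 / \<beta>)"
  have root: "\<gamma> powr (1 / \<beta>) * \<tau> ^ k \<le> K powr (1 / \<beta>) * fact k" for k
  proof -
    have "(\<gamma> * \<rho> ^ k) powr (1 / \<beta>) \<le> (K * fact k powr \<beta>) powr (1 / \<beta>)"
      using pos le[of k] by (intro powr_mono2) auto
    moreover have "(\<rho> ^ k) powr (1 / \<beta>) = \<tau> ^ k"
      using pos by (simp add: \<tau>_def powr_powr powr_realpow[symmetric] mult.commute)
    ultimately show ?thesis using pos by (simp add: powr_mult powr_powr)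
  qed
  \<comment> \<open>Halving \<open>\<tau>\<close> pays for a geometric majorant.\<close>
  have lhs: "(\<lambda>k. \<gamma> powr (1 / \<beta>) * ((\<tau> / 2) ^ k /\<^sub>R fact k)) sums (\<gamma> powr (1 / \<beta>) * exp (\<tau> / 2))"
    by (intro sums_mult exp_converges)
  have rhs: "(\<lambda>k. K powr (1 / \<beta>) * (1 / 2) ^ k) sums (K powr (1 / \<beta>) * (1 / (1 - 1 / 2)))"
    by (intro sums_mult geometric_sums) simp
  have "\<gamma> powr (1 / \<beta>) * ((\<tau> / 2) ^ k /\<^sub>R fact k) \<le> K powr (1 / \<beta>) * (1 / 2) ^ k" for k
  proof -
    have "\<gamma> powr (1 / \<beta>) * \<tau> ^ k / fact k \<le> K powr (1 / \<beta>)"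
      using root[of k] by (simp add: divide_le_eq)
    then have "\<gamma> powr (1 / \<beta>) * \<tau> ^ k / fact k * (1 / 2) ^ k \<le> K powr (1 / \<beta>) * (1 / 2) ^ k"
      by (intro mult_right_mono) auto
    moreover have "\<gamma> powr (1 / \<beta>) * ((\<tau> / 2) ^ k /\<^sub>R fact k) = \<gamma> powr (1 / \<beta>) * \<tau> ^ k / fact k * (1 / 2) ^ k"
    proof -
      have "(\<tau> / 2) ^ k = \<tau> ^ k * (1 / 2) ^ k" using power_mult_distrib[of \<tau> "1 / 2" k] by simp
      then show ?thesis by (simp only: real_scaleR_def divide_inverse mult_ac)
    qed
    ultimately show ?thesis by (simp only:)
  qed
  then have "\<gamma> powr (1 / \<beta>) * exp (\<tau> / 2) \<le> K powr (1 / \<beta>) * (1 / (1 - 1 / 2))"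
    by (rule sums_le[OF _ lhs rhs])
  then show ?thesis by (simp add: \<tau>_def mult.commute)
qed

context scalar_type
begin

text \<open>
  Each term solves the equation in the strong sense, but the images of the terms under \<open>A\<close> need not
  be summable. Under a functional \<open>g\<close> in the domain of the adjoint, however, \<open>g (A (u n t))\<close> equals
  \<open>h (u n t)\<close> with \<open>h\<close> continuous, so uniform convergence of the series itself already allows
  termwise differentiation.
\<close>

lemma weak_solution_series:
  assumes \<Delta>: "\<And>n. \<Delta> n \<in> sets borel" "\<And>n. bounded (\<Delta> n)"
    and M: "\<And>T. T \<ge> 0 \<Longrightarrow> \<exists>M. summable M \<and>
      (\<forall>\<^sub>F n in sequentially. \<forall>t\<in>{0..T}. norm (Phi (pexp (\<Delta> n) 0 t) (x n)) \<le> M n)"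
  defines "y \<equiv> \<lambda>t. \<Sum>n. Phi (pexp (\<Delta> n) 0 t) (x n)"
  shows "weak_solution D A y"
    and "t \<ge> 0 \<Longrightarrow> (\<lambda>n. Phi (pexp (\<Delta> n) 0 t) (x n)) sums y t"
proof -
  define u where "u n t = Phi (pexp (\<Delta> n) 0 t) (x n)" for n t
  have ul: "uniform_limit {0..T} (\<lambda>n t. \<Sum>i<n. u i t) y sequentially" if "T \<ge> 0" for T
  proof -
    obtain M where "summable M" "\<forall>\<^sub>F n in sequentially. \<forall>t\<in>{0..T}. norm (u n t) \<le> M n"
      using M[OF \<open>T \<ge> 0\<close>] by (auto simp: u_def)
    then show ?thesis
      using Weierstrass_m_test_ev[of "{0..T}" u M] by (simp add: y_def u_def)
  qed
  have sums: "(\<lambda>n. u n t) sums y t" if "t \<ge> 0" for t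
    unfolding sums_def using tendsto_uniform_limitI[OF ul[OF that], of t] that by simp
  then show "t \<ge> 0 \<Longrightarrow> (\<lambda>n. Phi (pexp (\<Delta> n) 0 t) (x n)) sums y t" by (simp add: u_def)
  have du: "(u n has_vector_derivative A (u n t)) (at t within {0..T})"
    and uD: "u n t \<in> D" if t: "t \<in> {0..T}" for n t T
  proof -
    note bborel = bborel_pexp_bounded[OF \<Delta>[of n]]
    have u: "u n t = E (\<Delta> n) (u n t)" by (simp add: u_def E_Phi_pexp \<Delta> bborel)
    then show "u n t \<in> D" using E_in_domain(1)[OF \<Delta>] by metis
    have "A (u n t) = Phi (pexp (\<Delta> n) 1 0) (u n t)" using u E_in_domain(2)[OF \<Delta>] by metis
    also have "\<dots> = Phi (pexp (\<Delta> n) (0 + 1) t) (x n)"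
      by (simp add: u_def Phi_mult bborel pexp_mult)
    finally have A: "A (u n t) = Phi (pexp (\<Delta> n) (0 + 1) t) (x n)" .
    obtain C where C: "\<And>i z r. i \<in> {0, 0 + 1, 0 + 2} \<Longrightarrow> z \<in> \<Delta> n \<Longrightarrow> r \<in> {0..T} \<Longrightarrow>
        cmod (z ^ i * exp (of_real r * z)) \<le> C"
      using pexp_bounded_set3[OF \<Delta>(2)] by metis
    have "(u n has_vector_derivative Phi (pexp (\<Delta> n) (0 + 1) t) (x n)) (at t within {0..T})"
      unfolding u_def[abs_def]
      by (rule bounded_linear.has_vector_derivative[OF blinfun.bounded_linear_left
            Phi_pexp_deriv[OF \<Delta>(1) C t]])
    then show "(u n has_vector_derivative A (u n t)) (at t within {0..T})" by (simp only: A)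
  qed
  have nhd: "at t within {0..t + 1} = at t within {0..}" if "t \<ge> 0" for t :: real
    by (rule at_within_nhd[of _ "{..<t + 1}"]) (use that in auto)
  have cont: "continuous_on {0..} y"
    unfolding continuous_on_eq_continuous_within
  proof
    fix t :: real assume "t \<in> {0..}"
    then have t: "t \<ge> 0" by simp
    have "continuous_on {0..t + 1} (u n)" for n
      unfolding continuous_on_eq_continuous_within
      using du has_vector_derivative_continuous by blast
    then have "continuous_on {0..t + 1} y"
      using t by (intro uniform_limit_theorem[OF _ ul[of "t + 1"]] always_eventually allI
          continuous_on_sum) auto
    then have "continuous (at t within {0..t + 1}) y"
      using t by (simp add: continuous_on_eq_continuous_within)
    then show "continuous (at t within {0..}) y" by (simp add: nhd t)
  qed
  have "((\<lambda>s. g (y s)) has_vector_derivative adjoint_op D A g (y t)) (at t within {0..})"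
    if g: "g \<in> adjoint_domain D A" and t: "t \<ge> 0" for g t
  proof -
    obtain h where h: "bounded_clinear h" "\<And>x. x \<in> D \<Longrightarrow> g (A x) = h x" and gl: "bounded_clinear g"
      using g by (auto simp: adjoint_domain_def)
    interpret g: bounded_linear g by (rule bounded_clinear_imp_linear[OF gl])
    interpret h: bounded_linear h by (rule bounded_clinear_imp_linear[OF h(1)])
    let ?I = "{0..t + 1}"
    have lim: "uniform_limit ?I (\<lambda>n s. h (\<Sum>i<n. u i s)) (\<lambda>s. h (y s)) sequentially"
      using t by (intro h.uniform_limit ul) simp
    have "\<exists>G. \<forall>s\<in>?I. (\<lambda>n. g (u n s)) sums G s \<and>
        (G has_derivative (\<lambda>k. k *\<^sub>R h (y s))) (at s within ?I)"
    proof (rule has_derivative_series[where f' = "\<lambda>n s k. k *\<^sub>R h (u n s)" and x = 0])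
      fix n s assume s: "s \<in> ?I"
      have "((\<lambda>s. g (u n s)) has_vector_derivative g (A (u n s))) (at s within ?I)"
        by (rule g.has_vector_derivative[OF du[OF s]])
      then show "((\<lambda>s. g (u n s)) has_derivative (\<lambda>k. k *\<^sub>R h (u n s))) (at s within ?I)"
        using h(2)[OF uD[OF s]] by (simp add: has_vector_derivative_def)
    next
      fix e :: real assume "e > 0"
      from uniform_limitD[OF lim this]
      show "\<forall>\<^sub>F n in sequentially. \<forall>s\<in>?I. \<forall>k.
          norm ((\<Sum>i<n. k *\<^sub>R h (u i s)) - k *\<^sub>R h (y s)) \<le> e * norm k"
      proof eventually_elim
        case (elim n)
        show ?case
        proof (intro ballI allI)
          fix s k assume "s \<in> ?I"
          then have "norm (h (\<Sum>i<n. u i s) - h (y s)) \<le> e" using elim by (force simp: dist_norm)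
          then have "\<bar>k\<bar> * norm (h (\<Sum>i<n. u i s) - h (y s)) \<le> \<bar>k\<bar> * e"
            by (rule mult_left_mono) simp
          moreover have "(\<Sum>i<n. k *\<^sub>R h (u i s)) - k *\<^sub>R h (y s) = k *\<^sub>R (h (\<Sum>i<n. u i s) - h (y s))"
            by (simp add: h.sum scaleR_sum_right scaleR_diff_right)
          ultimately show "norm ((\<Sum>i<n. k *\<^sub>R h (u i s)) - k *\<^sub>R h (y s)) \<le> e * norm k"
            by (simp add: mult.commute)
        qed
      qed
    next
      show "(\<lambda>n. g (u n 0)) sums g (y 0)" by (rule g.sums[OF sums]) simp
    qed (use t in auto)
    then obtain G where G: "\<And>s. s \<in> ?I \<Longrightarrow> (\<lambda>n. g (u n s)) sums G s"
        "\<And>s. s \<in> ?I \<Longrightarrow> (G has_vector_derivative h (y s)) (at s within ?I)"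
      unfolding has_vector_derivative_def by blast
    have Gy: "g (y s) = G s" if s: "s \<in> ?I" for s
    proof -
      have "(\<lambda>n. g (u n s)) sums g (y s)" by (rule g.sums[OF sums]) (use s in simp)
      then show ?thesis using G(1)[OF s] by (rule sums_unique2)
    qed
    have "((\<lambda>s. g (y s)) has_vector_derivative h (y t)) (at t within ?I)"
      by (rule has_vector_derivative_transform[OF _ Gy G(2)]) (use t in auto)
    moreover have "adjoint_op D A g = h" by (rule adjoint_unique[OF h])
    ultimately show ?thesis by (simp add: nhd t)
  qed
  then show "weak_solution D A y" using cont by (simp add: weak_solution_def)
qed

text \<open>
  Projecting a smooth function to a bounded part of the spectrum commutes with differentiation, and
  if the projection follows the exponential there, then all its derivatives are known.
\<close>

lemma weak_solution_part_nth_deriv: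
  assumes y: "y \<in> C_infinity {0..}"
    and \<delta>: "\<delta> \<in> sets borel" "bounded \<delta>"
    and part: "\<And>t. t \<ge> 0 \<Longrightarrow> E \<delta> (y t) = Phi (pexp \<delta> 0 t) x"
    and t: "t \<ge> 0"
  shows "E \<delta> (nth_deriv {0..} k y t) = Phi (pexp \<delta> k t) x"
  using t
proof (induction k arbitrary: t)
  case (Suc k)
  have "nth_deriv {0..} k y differentiable (at t within {0..})"
    using y Suc.prems by (simp add: C_infinity_def differentiable_on_def)
  then have "(nth_deriv {0..} k y has_vector_derivative nth_deriv {0..} (Suc k) y t) (at t within {0..})"
    by (simp add: vector_derivative_works)
  then have 1: "((\<lambda>s. E \<delta> (nth_deriv {0..} k y s)) has_vector_derivative
      E \<delta> (nth_deriv {0..} (Suc k) y t)) (at t within {0..})"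
    by (rule bounded_linear.has_vector_derivative[OF linear[OF \<delta>(1)]])
  obtain C where C: "\<And>i z r. i \<in> {k, k + 1, k + 2} \<Longrightarrow> z \<in> \<delta> \<Longrightarrow> r \<in> {0..t + 1} \<Longrightarrow>
      cmod (z ^ i * exp (of_real r * z)) \<le> C"
    using pexp_bounded_set3[OF \<delta>(2)] by metis
  have "((\<lambda>s. Phi (pexp \<delta> k s) x) has_vector_derivative Phi (pexp \<delta> (k + 1) t) x) (at t within {0..t + 1})"
    by (rule bounded_linear.has_vector_derivative[OF blinfun.bounded_linear_left
          Phi_pexp_deriv[OF \<delta>(1) C]]) (use Suc.prems in auto)
  moreover have "at t within {0..t + 1} = at t within {0..}"
    by (rule at_within_nhd[of _ "{..<t + 1}"]) (use Suc.prems in auto)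
  ultimately have d: "((\<lambda>s. Phi (pexp \<delta> k s) x) has_vector_derivative Phi (pexp \<delta> (k + 1) t) x) (at t within {0..})"
    by simp
  have "((\<lambda>s. E \<delta> (nth_deriv {0..} k y s)) has_vector_derivative Phi (pexp \<delta> (k + 1) t) x) (at t within {0..})"
    by (rule has_vector_derivative_transform[OF _ Suc.IH d]) (use Suc.prems in auto)
  from vector_derivative_unique_within[OF at_within_atLeast_neq_bot[OF Suc.prems] 1 this]
  show ?case by simp
qed (use part in simp)

text \<open>
  On a set away from \<open>0\<close> the function \<open>1 / z ^ k\<close> is bounded, so the operator with symbol \<open>z ^ k\<close> is
  inverted by the calculus, with an estimate that is uniform in \<open>k\<close> up to the factor \<open>q ^ k\<close>.
\<close>

lemma Phi_pexp_power_lower: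
  assumes \<delta>: "\<delta> \<in> sets borel" "bounded \<delta>" and x: "E \<delta> x = x"
    and q: "q > 0" "\<And>z. z \<in> \<delta> \<Longrightarrow> cmod z \<ge> q"
  shows "q ^ k * norm x \<le> 4 * E_bound * norm (Phi (pexp \<delta> k 0) x)"
proof -
  define f where "f z = indicator \<delta> z * inverse (z ^ k)" for z :: complex
  have fb: "cmod (f z) \<le> inverse (q ^ k)" for z
  proof (cases "z \<in> \<delta>")
    case True
    then show ?thesis
      using q by (auto simp: f_def norm_inverse norm_power intro!: le_imp_inverse_le power_mono)
  qed (use q in \<open>simp add: f_def\<close>)
  have bborel: "bborel f"
  proof (rule bborelI[OF _ fb])
    show "f \<in> borel_measurable borel" using \<delta>(1) unfolding f_def[abs_def] by measurable
  qed
  have "f z * pexp \<delta> k 0 z = indicator \<delta> z" for z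
  proof (cases "z \<in> \<delta>")
    case True
    then have "z \<noteq> 0" using q by force
    then show ?thesis using True by (simp add: f_def pexp_def)
  qed (simp add: f_def)
  then have "Phi f (Phi (pexp \<delta> k 0) x) = x"
    by (simp add: Phi_mult bborel bborel_pexp_bounded \<delta> Phi_indicator x)
  then have "norm x \<le> norm (Phi f) * norm (Phi (pexp \<delta> k 0) x)"
    using norm_blinfun[of "Phi f" "Phi (pexp \<delta> k 0) x"] by simp
  also have "\<dots> \<le> (4 * E_bound * inverse (q ^ k)) * norm (Phi (pexp \<delta> k 0) x)"
    using Phi_norm[OF bborel fb] by (intro mult_right_mono) auto
  finally show ?thesis using q(1) by (simp add: field_simps)
qed

text \<open>
  The gaps of \<open>3\<close> keep the unit balls around the points disjoint, and the lower bound \<open>2\<close> keeps these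
  balls away from the origin. The growth \<open>(n + 1)\<^sup>2\<close> of \<open>cmod (L n) powr (1 / \<beta>)\<close>, matched with the
  shrinking parameters \<open>1 / (n + 1)\<^sup>2\<close>, leaves room for a factor \<open>n\<close> in front of the real part.
\<close>

lemma not_sector_imp_sequence:
  assumes "\<not> (\<exists>b>0. bounded (S - P_region \<beta> b))"
  shows "\<exists>L :: nat \<Rightarrow> complex.
    (\<forall>n. L n \<in> S \<and> L n \<notin> P_region \<beta> (1 / (real n + 1)\<^sup>2) \<and>
      cmod (L n) \<ge> 2 \<and> cmod (L n) \<ge> ((real n + 1)\<^sup>2) powr \<beta>) \<and>
    (\<forall>m n. m < n \<longrightarrow> cmod (L m) + 3 \<le> cmod (L n))"
proof -
  define P where "P n z \<longleftrightarrow> z \<in> S \<and> z \<notin> P_region \<beta> (1 / (real n + 1)\<^sup>2) \<and>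
    cmod z \<ge> 2 \<and> cmod z \<ge> ((real n + 1)\<^sup>2) powr \<beta>" for n z
  have far: "\<exists>z. P n z \<and> cmod z \<ge> R" for n R
  proof -
    have "\<not> bounded (S - P_region \<beta> (1 / (real n + 1)\<^sup>2))"
      using assms by (simp add: add_pos_nonneg)
    then obtain z where "z \<in> S - P_region \<beta> (1 / (real n + 1)\<^sup>2)"
        "\<not> cmod z \<le> max R (max 2 (((real n + 1)\<^sup>2) powr \<beta>))"
      unfolding bounded_iff by blast
    then show ?thesis by (intro exI[of _ z]) (auto simp: P_def)
  qed
  have "\<exists>L. \<forall>n. P n (L n) \<and> cmod (L n) + 3 \<le> cmod (L (Suc n))"
    by (rule dependent_nat_choice) (use far in blast)+
  then obtain L where L: "\<And>n. P n (L n)" and step: "\<And>n. cmod (L n) + 3 \<le> cmod (L (Suc n))"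
    by blast
  have mono: "cmod (L m) \<le> cmod (L n)" if "m \<le> n" for m n
    by (rule lift_Suc_mono_le[of "\<lambda>n. cmod (L n)", OF _ that]) (use step in \<open>smt (verit)\<close>)
  have "cmod (L m) + 3 \<le> cmod (L n)" if "m < n" for m n
    using step[of m] mono[of "Suc m" n] that by simp
  with L show ?thesis unfolding P_def by blast
qed

text \<open>
  If the spectral condition fails, a solution outside the Roumieu class superposes unit vectors \<open>e n\<close> from the spectral subspaces of small discs around
  the points \<open>L n\<close>. The weights \<open>exp (- n r n)\<close> make the series converge at every time, since
  the growth \<open>exp (t r n)\<close> of its terms is eventually dominated. A Gevrey bound at time \<open>0\<close>, seen
  through the projection to the \<open>n\<close>-th disc, would require weights of size at most
  \<open>exp (- const cmod (L n) powr (1 / \<beta>))\<close>; but outside the regions \<open>P\<close> the exponent \<open>n r n\<close> is of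
  smaller order than that.
\<close>

lemma roumieu_imp_sector:
  assumes \<beta>: "\<beta> \<ge> 1"
    and roumieu: "\<And>y. weak_solution D A y \<Longrightarrow> y \<in> gevrey_roumieu \<beta> {0..}"
  shows "\<exists>b>0. bounded (S - P_region \<beta> b)"
proof (rule ccontr)
  assume "\<not> ?thesis"
  from not_sector_imp_sequence[OF this]
  obtain L where LS: "\<And>n. L n \<in> S"
    and LP: "\<And>n. L n \<notin> P_region \<beta> (1 / (real n + 1)\<^sup>2)"
    and L2: "\<And>n. cmod (L n) \<ge> 2" and Lbig: "\<And>n. cmod (L n) \<ge> ((real n + 1)\<^sup>2) powr \<beta>"
    and gap: "\<And>m n. m < n \<Longrightarrow> cmod (L m) + 3 \<le> cmod (L n)"
    by blast
  define \<Delta> where "\<Delta> n = ball (L n) 1" for n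
  define r where "r n = max (Re (L n)) 0 + 1" for n
  define c where "c n = exp (- (real n * r n))" for n
  have \<Delta>: "\<Delta> n \<in> sets borel" "bounded (\<Delta> n)" for n by (auto simp: \<Delta>_def)
  have disj: "\<Delta> m \<inter> \<Delta> n = {}" if "m \<noteq> n" for m n
  proof -
    have "\<Delta> m \<inter> \<Delta> n = {}" if "m < n" for m n
    proof (rule ccontr)
      assume "\<Delta> m \<inter> \<Delta> n \<noteq> {}"
      then obtain z where "cmod (L m - z) < 1" "cmod (L n - z) < 1"
        by (auto simp: \<Delta>_def dist_norm)
      then have "cmod (L n) < cmod (L m) + 2"
        using norm_triangle_ineq4[of "L n - z" "L m - z"] norm_triangle_ineq2[of "L n" "L m"]
        by simp
      then show False using gap[OF that] by simp
    qed
    then show ?thesis using \<open>m \<noteq> n\<close> by (metis Int_commute linorder_neqE_nat)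
  qed
  have "\<exists>e. norm e = 1 \<and> E (\<Delta> n) e = e" for n
  proof -
    have "\<Delta> n \<inter> S \<noteq> {}" using LS[of n] centre_in_ball[of "L n" 1] by (force simp: \<Delta>_def)
    then obtain v where v: "E (\<Delta> n) v \<noteq> 0"
      using open_meets_support[of "\<Delta> n"] by (auto simp: \<Delta>_def)
    define e where "e = E (\<Delta> n) v /\<^sub>R norm (E (\<Delta> n) v)"
    have "norm e = 1" using v by (simp add: e_def)
    moreover have "E (\<Delta> n) e = e"
      using linear_scale[OF bounded_linear.linear[OF linear[OF \<Delta>(1)]]]
      by (simp add: e_def E_E \<Delta>)
    ultimately show ?thesis by blast
  qed
  then obtain e where e: "\<And>n. norm (e n) = 1" "\<And>n. E (\<Delta> n) (e n) = e n" by metis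
  define x where "x n = c n *\<^sub>R e n" for n
  define y where "y t = (\<Sum>n. Phi (pexp (\<Delta> n) 0 t) (x n))" for t
  have r1: "r n \<ge> 1" for n by (simp add: r_def)
  have term_bound: "norm (Phi (pexp (\<Delta> n) 0 t) (x n)) \<le> 4 * E_bound * exp (T - real n)"
    if t: "t \<in> {0..T}" and n: "real n \<ge> T" for n t T
  proof -
    have ex: "cmod (z ^ 0 * exp (of_real t * z)) \<le> exp (T * r n)" if "z \<in> \<Delta> n" for z
    proof -
      have "cmod (z - L n) < 1" using that by (simp add: \<Delta>_def dist_norm norm_minus_commute)
      then have "Re z \<le> r n" using abs_Re_le_cmod[of "z - L n"] by (simp add: r_def)
      then have "t * Re z \<le> t * r n" using t by (intro mult_left_mono) auto
      also have "\<dots> \<le> T * r n" using t r1[of n] by (intro mult_right_mono) auto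
      finally show ?thesis by simp
    qed
    have "norm (Phi (pexp (\<Delta> n) 0 t)) \<le> 4 * E_bound * exp (T * r n)"
    proof (rule Phi_norm[OF bborel_pexp_bounded[OF \<Delta>]])
      show "cmod (pexp (\<Delta> n) 0 t z) \<le> exp (T * r n)" for z
        using ex[of z] by (auto simp: pexp_def indicator_def)
    qed
    then have "norm (Phi (pexp (\<Delta> n) 0 t) (x n)) \<le> (4 * E_bound * exp (T * r n)) * norm (x n)"
      by (intro order_trans[OF norm_blinfun] mult_right_mono) auto
    also have "norm (x n) = exp (- (real n * r n))" by (simp add: x_def c_def e)
    also have "(4 * E_bound * exp (T * r n)) * \<dots> = 4 * E_bound * exp ((T - real n) * r n)"
      by (simp add: algebra_simps flip: exp_add)
    also have "\<dots> \<le> 4 * E_bound * exp ((T - real n) * 1)"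
    proof -
      have "(T - real n) * r n \<le> (T - real n) * 1"
        using n r1[of n] by (intro mult_left_mono_neg) auto
      then show ?thesis using E_bound(1) by simp
    qed
    finally show ?thesis by simp
  qed
  have M: "\<exists>M. summable M \<and>
      (\<forall>\<^sub>F n in sequentially. \<forall>t\<in>{0..T}. norm (Phi (pexp (\<Delta> n) 0 t) (x n)) \<le> M n)" for T :: real
  proof (intro exI conjI)
    have "summable (\<lambda>n. (4 * E_bound * exp T) * exp (- 1) ^ n)"
      by (intro summable_mult summable_geometric) simp
    then show "summable (\<lambda>n. 4 * E_bound * exp (T - real n))"
      by (simp add: exp_diff exp_minus exp_of_nat_mult[of _ 1, simplified] power_inverse field_simps)
    obtain N where "T \<le> real N" using real_arch_simple by blast
    then have "\<forall>t\<in>{0..T}. norm (Phi (pexp (\<Delta> n) 0 t) (x n)) \<le> 4 * E_bound * exp (T - real n)"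
      if "n \<ge> N" for n
      using term_bound[of _ T n] that by (simp add: order_trans)
    then show "\<forall>\<^sub>F n in sequentially. \<forall>t\<in>{0..T}.
        norm (Phi (pexp (\<Delta> n) 0 t) (x n)) \<le> 4 * E_bound * exp (T - real n)"
      by (auto simp: eventually_sequentially)
  qed
  have weak: "weak_solution D A y" and sums: "\<And>t. t \<ge> 0 \<Longrightarrow> (\<lambda>n. Phi (pexp (\<Delta> n) 0 t) (x n)) sums y t"
    using weak_solution_series[OF \<Delta> M] by (simp_all add: y_def[abs_def])
  then have G: "y \<in> gevrey_roumieu \<beta> {0..}" using roumieu by blast
  have "\<exists>\<alpha>>0. \<exists>K>0. \<forall>k. \<forall>t\<in>{0..1}.
      norm (nth_deriv {0..} k y t) \<le> K * \<alpha> ^ k * fact k powr \<beta>"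
    using G unfolding gevrey_roumieu_def by (simp del: atLeastAtMost_iff)
  then obtain \<alpha> K where \<alpha>: "\<alpha> > 0" and K: "K > 0"
    and bnd: "\<And>k t. t \<in> {0..1} \<Longrightarrow> norm (nth_deriv {0..} k y t) \<le> K * \<alpha> ^ k * fact k powr \<beta>"
    by metis
  have part: "E (\<Delta> n) (y t) = Phi (pexp (\<Delta> n) 0 t) (x n)" if "t \<ge> 0" for n t
  proof -
    have "(\<lambda>m. E (\<Delta> n) (Phi (pexp (\<Delta> m) 0 t) (x m))) sums E (\<Delta> n) (y t)"
      by (rule bounded_linear.sums[OF linear[OF \<Delta>(1)] sums[OF that]])
    moreover have "E (\<Delta> n) (Phi (pexp (\<Delta> m) 0 t) (x m)) =
        (if m = n then Phi (pexp (\<Delta> n) 0 t) (x n) else 0)" for m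
    proof (cases "m = n")
      case False
      have "pexp {} 0 t = (\<lambda>_. 0)" by (auto simp: pexp_def)
      then show ?thesis
        using False disj[of n m] Phi_const[of 0 "x m"]
        by (simp add: E_Phi_pexp \<Delta> bborel_pexp_bounded)
    qed (simp add: E_Phi_pexp \<Delta> bborel_pexp_bounded)
    ultimately have "(\<lambda>m. if m = n then Phi (pexp (\<Delta> n) 0 t) (x n) else 0) sums E (\<Delta> n) (y t)"
      by simp
    moreover have "(\<lambda>m. if m = n then Phi (pexp (\<Delta> n) 0 t) (x n) else 0) sums Phi (pexp (\<Delta> n) 0 t) (x n)"
      using sums_If_finite_set[of "{n}" "\<lambda>_. Phi (pexp (\<Delta> n) 0 t) (x n)"] by simp
    ultimately show ?thesis by (rule sums_unique2)
  qed
  have yC: "y \<in> C_infinity {0..}" using G by (simp add: gevrey_roumieu_def)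
  define K' where "K' = 4 * E_bound * E_bound * K"
  have K': "K' > 0" using K E_bound(1) by (simp add: K'_def)
  define \<rho> where "\<rho> n = cmod (L n) / (2 * \<alpha>)" for n
  have \<rho>: "\<rho> n > 0" for n using L2[of n] \<alpha> unfolding \<rho>_def
    by (intro divide_pos_pos) linarith+
  have main: "c n * \<rho> n ^ k \<le> K' * fact k powr \<beta>" for n k
  proof -
    have near: "cmod z \<ge> cmod (L n) / 2" if "z \<in> \<Delta> n" for z
    proof -
      have "cmod (L n - z) < 1" using that by (simp add: \<Delta>_def dist_norm)
      then show ?thesis using norm_triangle_ineq2[of "L n" z] L2[of n] by simp
    qed
    have xE: "E (\<Delta> n) (x n) = x n"
      using linear_scale[OF bounded_linear.linear[OF linear[OF \<Delta>(1)]]] by (simp add: x_def e)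
    have "(cmod (L n) / 2) ^ k * norm (x n) \<le> 4 * E_bound * norm (Phi (pexp (\<Delta> n) k 0) (x n))"
      by (rule Phi_pexp_power_lower[OF \<Delta> xE _ near]) (use L2[of n] in auto)
    also have "Phi (pexp (\<Delta> n) k 0) (x n) = E (\<Delta> n) (nth_deriv {0..} k y 0)"
      using weak_solution_part_nth_deriv[OF yC \<Delta> part, of 0 n k] by simp
    also have "4 * E_bound * norm (E (\<Delta> n) (nth_deriv {0..} k y 0)) \<le>
        4 * E_bound * (E_bound * (K * \<alpha> ^ k * fact k powr \<beta>))"
      using E_bound(1) order_trans[OF E_bound(2)[OF \<Delta>(1)] mult_left_mono[OF bnd[of 0 k]]]
      by (intro mult_left_mono) auto
    finally have "(cmod (L n) / 2) ^ k * c n \<le> K' * \<alpha> ^ k * fact k powr \<beta>"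
      by (simp add: x_def e c_def K'_def mult_ac)
    then have "((cmod (L n) / 2) ^ k * c n) / \<alpha> ^ k \<le> K' * fact k powr \<beta>"
      using \<alpha> by (simp add: divide_le_eq mult_ac)
    then show ?thesis using \<alpha> by (simp add: \<rho>_def power_divide power_mult_distrib mult_ac)
  qed
  define \<kappa> where "\<kappa> = (1 / (2 * \<alpha>)) powr (1 / \<beta>)"
  have \<kappa>: "\<kappa> > 0" using \<alpha> by (simp add: \<kappa>_def)
  define Q where "Q = 2 * K' powr (1 / \<beta>)"
  have upper: "\<kappa> * (real n + 1)\<^sup>2 * (1 / 2 - 2 / (\<kappa> * (real n + 1))) \<le> Q"
    if n: "real n + 1 \<ge> 4 / \<kappa>" for n
  proof -
    let ?N = "real n + 1" and ?l = "cmod (L n) powr (1 / \<beta>)"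
    have "(?N\<^sup>2 powr \<beta>) powr (1 / \<beta>) \<le> ?l" using Lbig[of n] \<beta> by (intro powr_mono2) auto
    then have l: "?N\<^sup>2 \<le> ?l" using \<beta> by (simp add: powr_powr)
    have "Re (L n) < 1 / ?N\<^sup>2 * \<bar>Im (L n)\<bar> powr (1 / \<beta>)"
      using LP[of n] by (simp add: P_region_def)
    also have "\<dots> \<le> 1 / ?N\<^sup>2 * ?l"
      using abs_Im_le_cmod \<beta> by (intro mult_left_mono powr_mono2) auto
    finally have "Re (L n) \<le> ?l / ?N\<^sup>2" by simp
    moreover have "0 \<le> ?l / ?N\<^sup>2" by simp
    moreover have "1 \<le> ?l / ?N\<^sup>2" using l by (simp add: le_divide_eq)
    ultimately have "r n \<le> 2 * (?l / ?N\<^sup>2)" unfolding r_def by linarith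
    then have "real n * r n \<le> ?N * (2 * (?l / ?N\<^sup>2))"
      using r1[of n] by (intro mult_mono) auto
    also have "\<dots> = 2 * ?l / ?N" by (simp add: power2_eq_square)
    finally have nr: "real n * r n \<le> 2 * ?l / ?N" .
    have "real n * r n / \<beta> \<le> real n * r n / 1"
      using \<beta> r1[of n] by (intro divide_left_mono) auto
    then have nr\<beta>: "real n * r n / \<beta> \<le> 2 * ?l / ?N" using nr by simp
    have "c n powr (1 / \<beta>) * exp (\<rho> n powr (1 / \<beta>) / 2) \<le> Q"
      unfolding Q_def by (rule fact_powr_bound_imp_exp_bound[OF _ \<rho> K' \<beta> main]) (simp add: c_def)
    moreover have "c n powr (1 / \<beta>) = exp (- (real n * r n / \<beta>))"
      by (simp add: c_def exp_powr_real)
    moreover have "\<rho> n powr (1 / \<beta>) = \<kappa> * ?l"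
      using \<alpha> powr_mult[of "1 / (2 * \<alpha>)" "cmod (L n)" "1 / \<beta>"] by (simp add: \<rho>_def \<kappa>_def)
    ultimately have "exp (- (real n * r n / \<beta>)) * exp (\<kappa> * ?l / 2) \<le> Q" by simp
    then have "exp (\<kappa> * ?l / 2 - real n * r n / \<beta>) \<le> Q"
      by (simp only: mult_exp_exp) (simp only: add.commute diff_conv_add_uminus)
    moreover have "\<kappa> * ?l / 2 - real n * r n / \<beta> \<le> exp (\<kappa> * ?l / 2 - real n * r n / \<beta>)"
      using exp_ge_add_one_self[of "\<kappa> * ?l / 2 - real n * r n / \<beta>"] by linarith
    moreover have "\<kappa> * ?l * (1 / 2 - 2 / (\<kappa> * ?N)) \<le> \<kappa> * ?l / 2 - real n * r n / \<beta>"
      using nr\<beta> \<kappa> by (simp add: right_diff_distrib mult.commute)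
    moreover have "\<kappa> * ?N\<^sup>2 * (1 / 2 - 2 / (\<kappa> * ?N)) \<le> \<kappa> * ?l * (1 / 2 - 2 / (\<kappa> * ?N))"
      using l \<kappa> n by (intro mult_right_mono mult_left_mono) (auto simp: field_simps)
    ultimately show ?thesis by linarith
  qed
  \<comment> \<open>From \<open>8 / \<kappa>\<close> on the bracket in \<open>upper\<close> is at least \<open>1 / 4\<close>, and then its left-hand side is unbounded.\<close>
  obtain n where n: "real n \<ge> max (8 / \<kappa>) (4 * (\<bar>Q\<bar> + 1) / \<kappa>)" using real_arch_simple by blast
  let ?N = "real n + 1"
  have N: "?N \<ge> 8 / \<kappa>" "?N \<ge> 4 * (\<bar>Q\<bar> + 1) / \<kappa>" "?N \<ge> 1" using n by auto
  have "?N \<ge> 4 / \<kappa>" using N(1) \<kappa> by (simp add: field_simps)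
  note small = upper[OF this]
  define X where "X = \<kappa> * ?N\<^sup>2"
  have "X * (1 / 4) \<le> X * (1 / 2 - 2 / (\<kappa> * ?N))"
    using N(1) \<kappa> unfolding X_def by (intro mult_left_mono) (auto simp: field_simps)
  then have "X * (1 / 4) \<le> Q" using small unfolding X_def by (rule order_trans)
  moreover have "4 * (\<bar>Q\<bar> + 1) \<le> \<kappa> * ?N" using N(2) \<kappa> by (simp add: field_simps)
  then have "4 * (\<bar>Q\<bar> + 1) \<le> X"
    unfolding X_def
    by (rule order_trans) (use \<kappa> N(3) in \<open>intro mult_left_mono; auto simp: power2_eq_square\<close>)
  ultimately show False using abs_ge_self[of Q] by simp
qed

end

theorem theorem4p1:
  fixes D :: "'a::complex_banach set" and A :: "'a \<Rightarrow> 'a" and \<beta> :: real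
  assumes "scalar_type_spectral D A"
    and "1 \<le> \<beta>"
  shows "((\<forall>y. weak_solution D A y \<longrightarrow> y \<in> gevrey_beurling \<beta> {0..}) \<longleftrightarrow>
          (\<forall>y. weak_solution D A y \<longrightarrow> y \<in> gevrey_roumieu \<beta> {0..})) \<and>
         ((\<forall>y. weak_solution D A y \<longrightarrow> y \<in> gevrey_roumieu \<beta> {0..}) \<longleftrightarrow>
          (\<exists>b>0. bounded (spectrum D A - P_region \<beta> b)))"
proof -
  obtain E where "scalar_type E D A" using scalar_type_spectralE[OF assms(1)] .
  then interpret scalar_type E D A .
  have "gevrey_beurling \<beta> {0..} \<subseteq> (gevrey_roumieu \<beta> {0..} :: (real \<Rightarrow> 'a) set)"
    unfolding gevrey_beurling_def gevrey_roumieu_def using zero_less_one by blast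
  moreover have "\<exists>b>0. bounded (spectrum D A - P_region \<beta> b)"
    if "\<forall>y. weak_solution D A y \<longrightarrow> y \<in> gevrey_roumieu \<beta> {0..}"
    using roumieu_imp_sector[OF assms(2)] that support by simp
  moreover have "y \<in> gevrey_beurling \<beta> {0..}"
    if "weak_solution D A y" "\<exists>b>0. bounded (spectrum D A - P_region \<beta> b)" for y
    using sector_imp_beurling[OF that(1) assms(2)] that(2) support by auto
  ultimately show ?thesis by blast
qed

end
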